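(* Let $(P,C)$ be a weakly involutive poset, let $S$ be a finite poset containing $P$ as a subposet, and suppose that $S$ is contractible (i.e. its order complex is contractible). Then the geometric realization $|\Delta(\mathfrak{B}_S(P))|$ is $\mathbb{Z}_2$-homotopy equivalent to the suspension $Susp(|\Delta(\mathfrak{B}(P))|)$, where the involution on the suspension acts on $|\Delta(\mathfrak{B}(P))|$ by the involution induced from $(x,y)\mapsto(y,x)$ and interchanges the two suspension points.
   Context: A weakly involutive poset is a finite poset $(P,\leq)$ with a function $C:P\to P$ such that $x\leq y\Rightarrow C(y)\leq C(x)$ and $x\leq C(C(x))$ for all $x$. The box poset is $\mathfrak{B}(P)=\{(x,y)\in P\times P\mid x\leq C(y),\ y\leq C(x)\}$ with componentwise order and $\mathbb{Z}_2$-action $(x,y)\mapsto(y,x)$. Let $\widehat S=S\cup\{\widehat0\}$ with a new minimum $\widehat0$. The box poset of $P$ enriched over $S$ is the subposet of $\widehat S\times\widehat S$ (componentwise order) $\mathfrak{B}_S(P)=\mathfrak{B}(P)\cup\{(p,\widehat0)\mid p\in S\}\cup\{(\widehat0,q)\mid q\in S\}$, with action $(x,y)\mapsto(y,x)$. $\Delta(\cdot)$ denotes the order complex, with the induced simplicial involution; $\mathbb{Z}_2$-homotopy equivalence means equivariant maps both ways with composites equivariantly homotopic to the identities. *)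

theory Defs
  imports "HOL-Analysis.Analysis" "HOL-Library.Option_ord"
begin

section \<open>Posets\<close>

text \<open>
  A finite poset is a finite set of elements of a type of class \<open>order\<close>, ordered by the
  restriction of \<open>\<le>\<close>. Subposets are subsets. Every finite poset arises in this way up to
  isomorphism (embed it into the subsets of a set by principal down-sets). Pairs carry the
  componentwise order of \<open>HOL-Library.Product_Order\<close>.
\<close>

definition weakly_involutive_poset :: "'a::order set \<Rightarrow> ('a \<Rightarrow> 'a) \<Rightarrow> bool" where
  "weakly_involutive_poset P C \<longleftrightarrow>
     finite P \<and> C ` P \<subseteq> P \<and>
     (\<forall>x\<in>P. \<forall>y\<in>P. x \<le> y \<longrightarrow> C y \<le> C x) \<and>
     (\<forall>x\<in>P. x \<le> C (C x))"

definition box_poset :: "'a::order set \<Rightarrow> ('a \<Rightarrow> 'a) \<Rightarrow> ('a \<times> 'a) set" where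
  "box_poset P C = {(x, y). x \<in> P \<and> y \<in> P \<and> x \<le> C y \<and> y \<le> C x}"

text \<open>
  In \<open>HOL-Library.Option_ord\<close> the element \<open>None\<close> lies below every \<open>Some x\<close> and \<open>Some\<close> is an
  order embedding, so \<open>insert None (Some ` S)\<close> is \<open>S\<close> with a new minimum \<open>None\<close>.
\<close>

definition enriched_box_poset ::
    "'a::order set \<Rightarrow> 'a set \<Rightarrow> ('a \<Rightarrow> 'a) \<Rightarrow> ('a option \<times> 'a option) set" where
  "enriched_box_poset S P C =
     map_prod Some Some ` box_poset P C
     \<union> {(Some p, None) | p. p \<in> S}
     \<union> {(None, Some q) | q. q \<in> S}"


section \<open>Order complexes and geometric realizations\<close>

definition order_complex :: "'v::order set \<Rightarrow> 'v set set" where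
  "order_complex V =
     {\<sigma>. \<sigma> \<subseteq> V \<and> \<sigma> \<noteq> {} \<and> finite \<sigma> \<and> Complete_Partial_Order.chain (\<le>) \<sigma>}"

text \<open>
  Points are given by their barycentric coordinates. The topology is that of pointwise
  convergence of the coordinates, which for finite complexes, the only ones considered here,
  is the usual topology of the realization.
\<close>

definition geometric_realization :: "'v set set \<Rightarrow> ('v \<Rightarrow> real) topology" where
  "geometric_realization K =
     top_of_set {\<alpha>. (\<forall>v. 0 \<le> \<alpha> v) \<and> {v. \<alpha> v \<noteq> 0} \<in> K \<and> (\<Sum>v | \<alpha> v \<noteq> 0. \<alpha> v) = 1}"

text \<open>The affine extension of a simplicial map given on the vertices by \<open>f\<close>.\<close>

definition realization_map :: "('v \<Rightarrow> 'w) \<Rightarrow> ('v \<Rightarrow> real) \<Rightarrow> 'w \<Rightarrow> real" where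
  "realization_map f \<alpha> = (\<lambda>w. \<Sum>v | \<alpha> v \<noteq> 0 \<and> f v = w. \<alpha> v)"

lemma realization_map_swap:
  fixes \<alpha> :: "'a \<times> 'b \<Rightarrow> real"
  shows "realization_map prod.swap \<alpha> = \<alpha> \<circ> prod.swap"
proof
  fix w :: "'b \<times> 'a"
  have "{v. \<alpha> v \<noteq> 0 \<and> prod.swap v = w} = (if \<alpha> (prod.swap w) = 0 then {} else {prod.swap w})"
    by auto
  then show "realization_map prod.swap \<alpha> w = (\<alpha> \<circ> prod.swap) w"
    by (simp add: realization_map_def)
qed


section \<open>Suspensions\<close>

definition final_topology :: "'b set \<Rightarrow> 'a topology \<Rightarrow> ('a \<Rightarrow> 'b) \<Rightarrow> 'b topology" where
  "final_topology Y X f = topology (\<lambda>U. U \<subseteq> Y \<and> openin X {x \<in> topspace X. f x \<in> U})"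

lemma openin_final_topology:
  "openin (final_topology Y X f) U \<longleftrightarrow> U \<subseteq> Y \<and> openin X {x \<in> topspace X. f x \<in> U}"
proof -
  have "istopology (\<lambda>U. U \<subseteq> Y \<and> openin X {x \<in> topspace X. f x \<in> U})"
    unfolding istopology_def
  proof (intro conjI allI impI)
    fix U V
    assume U: "U \<subseteq> Y \<and> openin X {x \<in> topspace X. f x \<in> U}"
      and V: "V \<subseteq> Y \<and> openin X {x \<in> topspace X. f x \<in> V}"
    show "U \<inter> V \<subseteq> Y" using U by blast
    have "{x \<in> topspace X. f x \<in> U \<inter> V} =
        {x \<in> topspace X. f x \<in> U} \<inter> {x \<in> topspace X. f x \<in> V}" by blast
    then show "openin X {x \<in> topspace X. f x \<in> U \<inter> V}" using U V by auto
  next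
    fix \<K>
    assume K: "\<forall>U\<in>\<K>. U \<subseteq> Y \<and> openin X {x \<in> topspace X. f x \<in> U}"
    show "\<Union>\<K> \<subseteq> Y" using K by blast
    have "{x \<in> topspace X. f x \<in> \<Union>\<K>} = (\<Union>U\<in>\<K>. {x \<in> topspace X. f x \<in> U})" by blast
    then show "openin X {x \<in> topspace X. f x \<in> \<Union>\<K>}" using K by auto
  qed
  then show ?thesis
    by (simp add: final_topology_def)
qed

lemma topspace_final_topology:
  assumes "f ` topspace X \<subseteq> Y"
  shows "topspace (final_topology Y X f) = Y"
proof
  show "topspace (final_topology Y X f) \<subseteq> Y"
    by (metis openin_final_topology openin_topspace)
  have "{x \<in> topspace X. f x \<in> Y} = topspace X"
    using assms by blast
  then show "Y \<subseteq> topspace (final_topology Y X f)"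
    by (metis openin_final_topology openin_subset openin_topspace order_refl)
qed

datatype 'a susp = North | South | Level 'a real

definition susp_proj :: "'a \<times> real \<Rightarrow> 'a susp" where
  "susp_proj = (\<lambda>(x, t). if t = 1 then North else if t = - 1 then South else Level x t)"

definition susp_points :: "'a set \<Rightarrow> 'a susp set" where
  "susp_points A = {North, South} \<union> {Level x t | x t. x \<in> A \<and> - 1 < t \<and> t < 1}"

text \<open>
  The unreduced suspension: \<open>X \<times> [-1,1]\<close> with its two ends glued to the two suspension points.
  If \<open>X\<close> is nonempty, this is the quotient of \<open>X \<times> [-1,1]\<close> collapsing each end to a point.
  The suspension points are present also for empty \<open>X\<close>, so that the suspension of the empty
  space is the discrete space with two points.
\<close>

definition suspension :: "'a topology \<Rightarrow> 'a susp topology" where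
  "suspension X =
     final_topology (susp_points (topspace X)) (prod_topology X (top_of_set {-1..1})) susp_proj"

lemma topspace_suspension: "topspace (suspension X) = susp_points (topspace X)"
  unfolding suspension_def
  by (rule topspace_final_topology) (auto simp: susp_proj_def susp_points_def)

lemma quotient_map_susp_proj:
  assumes "topspace X \<noteq> {}"
  shows "quotient_map (prod_topology X (top_of_set {-1..1})) (suspension X) susp_proj"
proof -
  obtain a where a: "a \<in> topspace X" using assms by blast
  have *: "North = susp_proj (a, 1)" "South = susp_proj (a, - 1)"
    "\<And>x t. - 1 < t \<Longrightarrow> t < 1 \<Longrightarrow> Level x t = susp_proj (x, t)"
    by (auto simp: susp_proj_def)
  have "susp_proj ` (topspace X \<times> {-1..1}) = susp_points (topspace X)"
  proof
    show "susp_proj ` (topspace X \<times> {-1..1}) \<subseteq> susp_points (topspace X)"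
      by (auto simp: susp_proj_def susp_points_def)
    have "North \<in> susp_proj ` (topspace X \<times> {-1..1})"
      unfolding *(1) using a by (intro imageI) auto
    moreover have "South \<in> susp_proj ` (topspace X \<times> {-1..1})"
      unfolding *(2) using a by (intro imageI) auto
    moreover have "Level x t \<in> susp_proj ` (topspace X \<times> {-1..1})"
      if "x \<in> topspace X" "- 1 < t" "t < 1" for x t
      unfolding *(3)[OF that(2,3)] using that by (intro imageI) auto
    ultimately show "susp_points (topspace X) \<subseteq> susp_proj ` (topspace X \<times> {-1..1})"
      by (auto simp: susp_points_def)
  qed
  then show ?thesis
    unfolding quotient_map_def topspace_suspension
    by (auto simp: suspension_def openin_final_topology)
qed

fun susp_involution :: "('a \<Rightarrow> 'a) \<Rightarrow> 'a susp \<Rightarrow> 'a susp" where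
  "susp_involution \<sigma> North = South"
| "susp_involution \<sigma> South = North"
| "susp_involution \<sigma> (Level x t) = Level (\<sigma> x) (- t)"


section \<open>Spaces with an involution\<close>

definition Z2_space :: "'a topology \<Rightarrow> ('a \<Rightarrow> 'a) \<Rightarrow> bool" where
  "Z2_space X \<sigma> \<longleftrightarrow> continuous_map X X \<sigma> \<and> (\<forall>x\<in>topspace X. \<sigma> (\<sigma> x) = x)"

definition equivariant :: "'a topology \<Rightarrow> ('a \<Rightarrow> 'a) \<Rightarrow> ('b \<Rightarrow> 'b) \<Rightarrow> ('a \<Rightarrow> 'b) \<Rightarrow> bool" where
  "equivariant X \<sigma> \<tau> f \<longleftrightarrow> (\<forall>x\<in>topspace X. f (\<sigma> x) = \<tau> (f x))"

definition Z2_homotopy_equivalent ::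
    "'a topology \<Rightarrow> ('a \<Rightarrow> 'a) \<Rightarrow> 'b topology \<Rightarrow> ('b \<Rightarrow> 'b) \<Rightarrow> bool" where
  "Z2_homotopy_equivalent X \<sigma> Y \<tau> \<longleftrightarrow>
     Z2_space X \<sigma> \<and> Z2_space Y \<tau> \<and>
     (\<exists>f g. continuous_map X Y f \<and> equivariant X \<sigma> \<tau> f \<and>
            continuous_map Y X g \<and> equivariant Y \<tau> \<sigma> g \<and>
            homotopic_with (equivariant X \<sigma> \<sigma>) X X (g \<circ> f) id \<and>
            homotopic_with (equivariant Y \<tau> \<tau>) Y Y (f \<circ> g) id)"


section \<open>Contractible posets\<close>

text \<open>The empty space satisfies \<^const>\<open>contractible_space\<close> and has to be excluded.\<close>

definition contractible_poset :: "'a::order set \<Rightarrow> bool" where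
  "contractible_poset S \<longleftrightarrow>
     S \<noteq> {} \<and> contractible_space (geometric_realization (order_complex S))"

end

theory Submission
  imports Defs
begin

text \<open>
  Write \<open>B\<close> for the box poset and \<open>L\<close> for the left half \<open>B \<union> {(p, None) | p \<in> S}\<close> of the enriched box
  poset. The realization of the whole is the union of the realization of \<open>L\<close> and its mirror image,
  and these meet in the realization of \<open>B\<close>. The decreasing map \<open>(x, y) \<mapsto> (x, None)\<close> deforms \<open>L\<close> into a copy
  of the contractible poset \<open>S\<close>, hence \<open>L\<close> has a contraction \<open>\<Psi>\<close>. Collapsing the two copies of \<open>S\<close> to the
  poles gives a map to the suspension; conversely \<open>(x, t)\<close> with \<open>t \<ge> 0\<close> is sent to \<open>\<Psi> (t, x)\<close>, and the
  other half is treated by symmetry. All homotopies are constructed on the left half so that they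
  are fixed on \<open>B\<close>, which lets them extend equivariantly.
\<close>

section \<open>Spaces with an involution\<close>

text \<open>A contraction of the left half moves the points of \<open>B\<close>, so running it for a
  common time cannot be glued to its mirror image. Each point is instead moved for a time equal to
  its \<open>height\<close>, the mass on the pairs \<open>(p, None)\<close> minus the mass on the
  pairs \<open>(None, q)\<close>. This function is odd under the swap, vanishes exactly on the
  realization of \<open>B\<close>, and becomes the suspension coordinate. The suspension is modelled
  by pairs \<open>(y, t)\<close> of an unnormalized weight on \<open>B\<close> and a number with |t|
  + sum y = 1; the map into it is then restriction to \<open>B\<close> paired with
  \<open>height\<close>. A straight line in this model stays inside it if the supports of its ends
  lie in a common chain and their heights have the same sign. For this reason the contraction
  carries the extra information that no vertex of \<open>B\<close> outside the original support ever
  gains mass.\<close>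

lemma homotopic_with_equivariant:
  assumes "\<sigma> ` topspace X \<subseteq> topspace X"
  shows "homotopic_with (equivariant X \<sigma> \<tau>) X Y p q \<longleftrightarrow>
    (\<exists>h. continuous_map (prod_topology (top_of_set {0..1::real}) X) Y h \<and>
         (\<forall>x\<in>topspace X. h (0, x) = p x) \<and> (\<forall>x\<in>topspace X. h (1, x) = q x) \<and>
         (\<forall>t\<in>{0..1}. equivariant X \<sigma> \<tau> (\<lambda>x. h (t, x))))"
  \<comment> \<open>The library rule wants the property to depend only on values on
    \<open>topspace X\<close>; it does, because \<sigma> maps this set into itself.\<close>
  by (rule homotopic_with) (use assms in \<open>auto simp: equivariant_def image_subset_iff\<close>)

text \<open>Allows the quotient suspension to be exchanged for its coordinate model. Continuity and
  involutivity of \<upsilon> come from \<tau> by conjugation with \<phi>, so nothing has to be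
  checked on the quotient; homotopies are conjugated likewise.\<close>

lemma Z2_homotopy_equivalent_homeomorphic:
  assumes XY: "Z2_homotopy_equivalent X \<sigma> Y \<tau>"
    and hom: "homeomorphic_maps W Y \<phi> \<psi>"
    and \<upsilon>: "\<upsilon> ` topspace W \<subseteq> topspace W"
    and \<phi>: "equivariant W \<upsilon> \<tau> \<phi>"
  shows "Z2_homotopy_equivalent X \<sigma> W \<upsilon>"
proof -
  obtain f g where X: "Z2_space X \<sigma>" and Y: "Z2_space Y \<tau>"
    and f: "continuous_map X Y f" "equivariant X \<sigma> \<tau> f"
    and g: "continuous_map Y X g" "equivariant Y \<tau> \<sigma> g"
    and gf: "homotopic_with (equivariant X \<sigma> \<sigma>) X X (g \<circ> f) id"
    and fg: "homotopic_with (equivariant Y \<tau> \<tau>) Y Y (f \<circ> g) id"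
    using XY unfolding Z2_homotopy_equivalent_def by blast
  have c\<phi>: "continuous_map W Y \<phi>" and c\<psi>: "continuous_map Y W \<psi>"
    and \<psi>\<phi>: "\<And>w. w \<in> topspace W \<Longrightarrow> \<psi> (\<phi> w) = w"
    and \<phi>\<psi>: "\<And>y. y \<in> topspace Y \<Longrightarrow> \<phi> (\<psi> y) = y"
    using hom unfolding homeomorphic_maps_def by auto
  have inW: "\<psi> y \<in> topspace W" if "y \<in> topspace Y" for y
    using c\<psi> that by (auto simp: continuous_map_def)
  have inY: "\<phi> w \<in> topspace Y" if "w \<in> topspace W" for w
    using c\<phi> that by (auto simp: continuous_map_def)
  have in\<upsilon>: "\<upsilon> w \<in> topspace W" if "w \<in> topspace W" for w
    using \<upsilon> that by blast
  have c\<tau>: "continuous_map Y Y \<tau>"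
    using Y by (simp add: Z2_space_def)
  have in\<tau>: "\<tau> y \<in> topspace Y" if "y \<in> topspace Y" for y
    using c\<tau> that by (auto simp: continuous_map_def)
  have in\<sigma>: "\<sigma> x \<in> topspace X" if "x \<in> topspace X" for x
    using X that by (auto simp: Z2_space_def continuous_map_def)
  have inf: "f x \<in> topspace Y" if "x \<in> topspace X" for x
    using f that by (auto simp: continuous_map_def)
  have inX: "g y \<in> topspace X" if "y \<in> topspace Y" for y
    using g that by (auto simp: continuous_map_def)
  have \<phi>eq: "\<phi> (\<upsilon> w) = \<tau> (\<phi> w)" if "w \<in> topspace W" for w
    using \<phi> that by (auto simp: equivariant_def)
  have \<psi>eq: "\<psi> (\<tau> y) = \<upsilon> (\<psi> y)" if "y \<in> topspace Y" for y
    by (metis \<phi>eq \<phi>\<psi> \<psi>\<phi> in\<upsilon> inW that)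
  have W: "Z2_space W \<upsilon>"
    unfolding Z2_space_def
  proof
    have "continuous_map W W (\<psi> \<circ> \<tau> \<circ> \<phi>)"
      using c\<phi> c\<psi> c\<tau> by (intro continuous_map_compose)
    then show "continuous_map W W \<upsilon>"
      by (rule continuous_map_eq) (simp add: \<psi>eq \<psi>\<phi> inY)
    show "\<forall>w\<in>topspace W. \<upsilon> (\<upsilon> w) = w"
      using Y unfolding Z2_space_def by (metis \<phi>eq \<psi>\<phi> in\<upsilon> inY)
  qed
  obtain k where k: "continuous_map (prod_topology (top_of_set {0..1::real}) Y) Y k"
      "\<And>y. y \<in> topspace Y \<Longrightarrow> k (0, y) = f (g y)" "\<And>y. y \<in> topspace Y \<Longrightarrow> k (1, y) = y"
      "\<And>t y. t \<in> {0..1} \<Longrightarrow> y \<in> topspace Y \<Longrightarrow> k (t, \<tau> y) = \<tau> (k (t, y))"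
    using fg in\<tau> by (subst (asm) homotopic_with_equivariant) (force simp: equivariant_def)+
  have ink: "k (t, y) \<in> topspace Y" if "t \<in> {0..1}" "y \<in> topspace Y" for t y
    using k(1) that by (auto simp: continuous_map_def)
  have "homotopic_with (equivariant W \<upsilon> \<upsilon>) W W ((\<psi> \<circ> f) \<circ> (g \<circ> \<phi>)) id"
    unfolding homotopic_with_equivariant[OF \<upsilon>]
  proof (intro exI conjI ballI)
    have "continuous_map (prod_topology (top_of_set {0..1::real}) W) (prod_topology (top_of_set {0..1}) Y)
        (\<lambda>(t, w). (id t, \<phi> w))"
      by (subst continuous_map_prod_top) (use c\<phi> in auto)
    then show "continuous_map (prod_topology (top_of_set {0..1}) W) W
        (\<psi> \<circ> (k \<circ> (\<lambda>(t, w). (id t, \<phi> w))))"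
      by (intro continuous_map_compose[OF _ c\<psi>] continuous_map_compose[OF _ k(1)])
  next
    fix t :: real assume "t \<in> {0..1}"
    then show "equivariant W \<upsilon> \<upsilon> (\<lambda>w. (\<psi> \<circ> (k \<circ> (\<lambda>(t, w). (id t, \<phi> w)))) (t, w))"
      by (simp add: equivariant_def \<phi>eq k inY \<psi>eq ink)
  qed (simp_all add: k inY \<psi>\<phi>)
  moreover have "homotopic_with (equivariant X \<sigma> \<sigma>) X X ((g \<circ> \<phi>) \<circ> (\<psi> \<circ> f)) id"
  proof (rule homotopic_with_eq[OF gf])
    show "equivariant X \<sigma> \<sigma> h \<longleftrightarrow> equivariant X \<sigma> \<sigma> k"
      if "\<And>x. x \<in> topspace X \<Longrightarrow> h x = k x" for h k
      using that in\<sigma> by (auto simp: equivariant_def)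
  qed (simp_all add: \<phi>\<psi> inf)
  moreover have "equivariant X \<sigma> \<upsilon> (\<psi> \<circ> f)" "equivariant W \<upsilon> \<sigma> (g \<circ> \<phi>)"
    using f(2) g(2) by (auto simp: equivariant_def \<psi>eq inf \<phi>eq inY)
  ultimately show ?thesis
    unfolding Z2_homotopy_equivalent_def
    using X W continuous_map_compose[OF f(1) c\<psi>] continuous_map_compose[OF c\<phi> g(1)] by blast
qed

text \<open>With \<open>h\<close> odd under \<sigma>, the value on the half \<open>h < 0\<close> is
  the only one that equivariance allows.\<close>

definition equivariant_extension ::
    "('a \<Rightarrow> real) \<Rightarrow> ('a \<Rightarrow> 'a) \<Rightarrow> ('b \<Rightarrow> 'b) \<Rightarrow> ('a \<Rightarrow> 'b) \<Rightarrow> 'a \<Rightarrow> 'b" where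
  "equivariant_extension h \<sigma> \<tau> k z = (if 0 \<le> h z then k z else \<tau> (k (\<sigma> z)))"

text \<open>Pasting along the closed halves \<open>0 \<le> h\<close> and \<open>h \<le> 0\<close>:
  on \<open>h = 0\<close> the two formulas agree because \<open>k\<close> is equivariant there and
  \<tau> is an involution. With \<open>k\<close> constant in the time it also yields continuity and
  equivariance of a single map.\<close>

lemma equivariant_extension_homotopy:
  fixes Z :: "'a::topological_space set" and W :: "'b::topological_space set"
    and k :: "real \<times> 'a \<Rightarrow> 'b"
  assumes Z: "Z2_space (top_of_set Z) \<sigma>" and W: "Z2_space (top_of_set W) \<tau>"
    and h: "continuous_on Z h" "\<And>z. z \<in> Z \<Longrightarrow> h (\<sigma> z) = - h z"
    and k: "continuous_on ({0..1} \<times> {z \<in> Z. 0 \<le> h z}) k"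
           "\<And>s z. s \<in> {0..1} \<Longrightarrow> z \<in> Z \<Longrightarrow> 0 \<le> h z \<Longrightarrow> k (s, z) \<in> W"
           "\<And>s z. s \<in> {0..1} \<Longrightarrow> z \<in> Z \<Longrightarrow> h z = 0 \<Longrightarrow> k (s, \<sigma> z) = \<tau> (k (s, z))"
  shows "homotopic_with (equivariant (top_of_set Z) \<sigma> \<tau>) (top_of_set Z) (top_of_set W)
           (equivariant_extension h \<sigma> \<tau> (\<lambda>z. k (0, z))) (equivariant_extension h \<sigma> \<tau> (\<lambda>z. k (1, z)))"
proof -
  let ?K = "\<lambda>(s, z). equivariant_extension h \<sigma> \<tau> (\<lambda>z. k (s, z)) z"
  have \<sigma>: "continuous_on Z \<sigma>" "\<And>z. z \<in> Z \<Longrightarrow> \<sigma> z \<in> Z" "\<And>z. z \<in> Z \<Longrightarrow> \<sigma> (\<sigma> z) = z"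
    and \<tau>: "continuous_on W \<tau>" "\<And>z. z \<in> W \<Longrightarrow> \<tau> z \<in> W" "\<And>z. z \<in> W \<Longrightarrow> \<tau> (\<tau> z) = z"
    using Z W by (auto simp: Z2_space_def image_subset_iff)
  have sub: "\<sigma> ` topspace (top_of_set Z) \<subseteq> topspace (top_of_set Z)"
    using \<sigma> by auto
  have eq: "?K = (\<lambda>p. if 0 \<le> h (snd p) then k p else \<tau> (k (fst p, \<sigma> (snd p))))"
    by (auto simp: equivariant_extension_def)
  \<comment> \<open>The pasting rule puts its first branch on \<open>h \<le> a\<close>; replacing
    \<open>h\<close> by its negative turns that branch into the half
    \<open>0 \<le> h\<close>.\<close>
  note cases = continuous_on_cases_le[where h = "\<lambda>p. - h (snd p)" and a = 0,
      unfolded neg_le_0_iff_le neg_0_le_iff_le neg_equal_0_iff_equal]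
  have "continuous_on ({0..1} \<times> Z) ?K"
    unfolding eq
  proof (rule cases)
    show "continuous_on {t \<in> {0..1} \<times> Z. 0 \<le> h (snd t)} k"
      by (rule continuous_on_subset[OF k(1)]) auto
    show "continuous_on {t \<in> {0..1} \<times> Z. h (snd t) \<le> 0} (\<lambda>p. \<tau> (k (fst p, \<sigma> (snd p))))"
    proof (rule continuous_on_compose2[OF \<tau>(1)], rule continuous_on_compose2[OF k(1)])
      show "continuous_on {t \<in> {0..1} \<times> Z. h (snd t) \<le> 0} (\<lambda>x. (fst x, \<sigma> (snd x)))"
        by (intro continuous_intros continuous_on_compose2[OF \<sigma>(1)]) auto
    qed (use \<sigma> h k in auto)
    show "continuous_on ({0..1} \<times> Z) (\<lambda>p. - h (snd p))"
      by (intro continuous_intros continuous_on_compose2[OF h(1)]) auto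
    show "k t = \<tau> (k (fst t, \<sigma> (snd t)))" if "t \<in> {0..1} \<times> Z" "h (snd t) = 0" for t
      using that k(3)[of "fst t" "snd t"] k(2)[of "fst t" "snd t"] \<tau>(3)[of "k t"] by auto
  qed
  moreover have "?K ` ({0..1} \<times> Z) \<subseteq> W"
    using k(2) \<sigma> \<tau> h by (auto simp: equivariant_extension_def)
  moreover have "equivariant (top_of_set Z) \<sigma> \<tau> (\<lambda>z. ?K (s, z))" if s: "s \<in> {0..1}" for s
    unfolding equivariant_def
  proof
    fix z assume z: "z \<in> topspace (top_of_set Z)"
    then have z: "z \<in> Z" by simp
    \<comment> \<open>For \<open>h z = 0\<close> both \<open>z\<close> and its mirror image take the
      first branch, and the compatibility of \<open>k\<close> is used; otherwise the branches are
      exchanged and it suffices that the involutions square to the identity.\<close>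
    consider "h z < 0" | "h z = 0" | "0 < h z" by linarith
    then show "?K (s, \<sigma> z) = \<tau> (?K (s, z))"
      by cases (use s z \<sigma> h(2)[OF z] k \<tau> in \<open>auto simp: equivariant_extension_def\<close>)
  qed
  ultimately show ?thesis
    unfolding homotopic_with_equivariant[OF sub]
    by - (rule exI[of _ ?K], auto simp: equivariant_def)
qed

section \<open>Realizations of finite posets\<close>

text \<open>The cone over the realization, with the zero weight as apex. Leaving the mass free
  permits restricting, scaling and splitting weights.\<close>

definition chain_weights :: "'v::order set \<Rightarrow> ('v \<Rightarrow> real) set" where
  "chain_weights V = {\<alpha>. (\<forall>v. 0 \<le> \<alpha> v) \<and> (\<forall>v. v \<notin> V \<longrightarrow> \<alpha> v = 0) \<and>
     (\<forall>v w. \<alpha> v \<noteq> 0 \<longrightarrow> \<alpha> w \<noteq> 0 \<longrightarrow> v \<le> w \<or> w \<le> v)}"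

definition chain_points :: "'v::order set \<Rightarrow> ('v \<Rightarrow> real) set" where
  "chain_points V = {\<alpha> \<in> chain_weights V. sum \<alpha> V = 1}"

lemma chain_weightsD:
  assumes "\<alpha> \<in> chain_weights V"
  shows "0 \<le> \<alpha> v" "v \<notin> V \<Longrightarrow> \<alpha> v = 0" "\<alpha> v \<noteq> 0 \<Longrightarrow> v \<in> V"
    "\<alpha> v \<noteq> 0 \<Longrightarrow> \<alpha> w \<noteq> 0 \<Longrightarrow> v \<le> w \<or> w \<le> v"
  using assms by (auto simp: chain_weights_def)

lemma chain_weights_mono:
  assumes "\<alpha> \<in> chain_weights V" "\<And>v. 0 \<le> \<beta> v" "\<And>v. \<beta> v \<noteq> 0 \<Longrightarrow> \<alpha> v \<noteq> 0"
  shows "\<beta> \<in> chain_weights V"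
  using assms unfolding chain_weights_def by blast

lemma chain_points_weights: "\<alpha> \<in> chain_points V \<Longrightarrow> \<alpha> \<in> chain_weights V"
  and chain_points_sum: "\<alpha> \<in> chain_points V \<Longrightarrow> sum \<alpha> V = 1"
  by (auto simp: chain_points_def)

text \<open>Sums over the fixed finite set \<open>V\<close> replace sums over the varying support,
  as continuity arguments require. Nonemptiness of the support is forced by the total mass
  1.\<close>

lemma geometric_realization_order_complex:
  assumes "finite V"
  shows "geometric_realization (order_complex V) = top_of_set (chain_points V)"
proof -
  have "{\<alpha>. (\<forall>v. 0 \<le> \<alpha> v) \<and> {v. \<alpha> v \<noteq> 0} \<in> order_complex V \<and> (\<Sum>v | \<alpha> v \<noteq> 0. \<alpha> v) = 1}
      = chain_points V"
  proof (intro set_eqI iffI)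
    fix \<alpha> :: "'a \<Rightarrow> real"
    assume "\<alpha> \<in> chain_points V"
    then have \<alpha>: "\<alpha> \<in> chain_weights V" "sum \<alpha> V = 1" by (auto simp: chain_points_def)
    have "{v. \<alpha> v \<noteq> 0} \<subseteq> V" using chain_weightsD[OF \<alpha>(1)] by auto
    moreover from this have "(\<Sum>v | \<alpha> v \<noteq> 0. \<alpha> v) = sum \<alpha> V"
      using assms by (intro sum.mono_neutral_left) auto
    moreover from this have "{v. \<alpha> v \<noteq> 0} \<noteq> {}" using \<alpha>(2) by (metis sum.empty zero_neq_one)
    ultimately show "\<alpha> \<in> {\<alpha>. (\<forall>v. 0 \<le> \<alpha> v) \<and> {v. \<alpha> v \<noteq> 0} \<in> order_complex V \<and>
        (\<Sum>v | \<alpha> v \<noteq> 0. \<alpha> v) = 1}"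
      using chain_weightsD[OF \<alpha>(1)] \<alpha>(2) assms
      by (auto simp: order_complex_def Complete_Partial_Order.chain_def intro: finite_subset)
  next
    fix \<alpha> :: "'a \<Rightarrow> real"
    assume \<alpha>: "\<alpha> \<in> {\<alpha>. (\<forall>v. 0 \<le> \<alpha> v) \<and> {v. \<alpha> v \<noteq> 0} \<in> order_complex V \<and>
        (\<Sum>v | \<alpha> v \<noteq> 0. \<alpha> v) = 1}"
    then have "{v. \<alpha> v \<noteq> 0} \<subseteq> V" by (auto simp: order_complex_def)
    moreover from this have "(\<Sum>v | \<alpha> v \<noteq> 0. \<alpha> v) = sum \<alpha> V"
      using assms by (intro sum.mono_neutral_left) auto
    ultimately show "\<alpha> \<in> chain_points V"
      using \<alpha> by (auto simp: order_complex_def Complete_Partial_Order.chain_def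
          chain_points_def chain_weights_def)
  qed
  then show ?thesis by (simp add: geometric_realization_def)
qed

lemma closed_chain_points:
  assumes "finite V"
  shows "closed (chain_points V)"
proof -
  \<comment> \<open>Written as the vanishing of \<open>\<alpha> v * \<alpha> w\<close> for each
    incomparable pair, the chain condition is visibly closed.\<close>
  have "chain_points V = {\<alpha>. (\<forall>v. 0 \<le> \<alpha> v) \<and> (\<forall>v. v \<notin> V \<longrightarrow> \<alpha> v = 0) \<and>
     (\<forall>v w. v \<le> w \<or> w \<le> v \<or> \<alpha> v * \<alpha> w = 0) \<and> sum \<alpha> V = 1}"
    by (auto simp: chain_points_def chain_weights_def)
  also have "closed \<dots>"
    by (intro closed_Collect_conj closed_Collect_all closed_Collect_imp closed_Collect_disj
        closed_Collect_le closed_Collect_eq closed_Collect_const open_Collect_const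
        continuous_on_sum continuous_on_mult continuous_on_product_coordinates
        continuous_on_const)
  finally show ?thesis .
qed

text \<open>A closed subset of a cube that is compact by Tychonoff, even for an infinite vertex
  type. Compactness later makes the coordinate map on the suspension a homeomorphism.\<close>

lemma compact_chain_points:
  assumes "finite V"
  shows "compact (chain_points V)"
proof -
  have "compactin (product_topology (\<lambda>_. euclideanreal) UNIV) (PiE UNIV (\<lambda>_::'a. {0..1::real}))"
    unfolding compactin_PiE by simp
  then have "compact (PiE UNIV (\<lambda>_::'a. {0..1::real}))"
    by (simp add: euclidean_product_topology)
  moreover have "chain_points V \<subseteq> PiE UNIV (\<lambda>_::'a. {0..1::real})"
  proof
    fix \<alpha> assume \<alpha>: "\<alpha> \<in> chain_points V"
    have "\<alpha> v \<le> 1" for v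
    proof (cases "v \<in> V")
      case True
      then have "\<alpha> v \<le> sum \<alpha> V"
        using assms chain_weightsD(1)[OF chain_points_weights[OF \<alpha>]]
        by (intro member_le_sum) auto
      then show ?thesis using \<alpha> by (simp add: chain_points_def)
    qed (use chain_weightsD(2)[OF chain_points_weights[OF \<alpha>]] in auto)
    then show "\<alpha> \<in> PiE UNIV (\<lambda>_::'a. {0..1::real})"
      using chain_weightsD(1)[OF chain_points_weights[OF \<alpha>]] by auto
  qed
  ultimately show ?thesis
    using closed_chain_points[OF assms] compact_Int_closed[of "PiE UNIV (\<lambda>_::'a. {0..1::real})"]
    by (metis Int_absorb1)
qed

section \<open>Affine extensions of monotone maps\<close>

lemma realization_map_eq_sum:
  assumes "finite V" "\<And>v. v \<notin> V \<Longrightarrow> \<alpha> v = 0"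
  shows "realization_map f \<alpha> w = (\<Sum>v\<in>V. if f v = w then \<alpha> v else 0)"
proof -
  have "realization_map f \<alpha> w = (\<Sum>v | \<alpha> v \<noteq> 0 \<and> f v = w. if f v = w then \<alpha> v else 0)"
    unfolding realization_map_def by (intro sum.cong) auto
  also have "\<dots> = (\<Sum>v\<in>V. if f v = w then \<alpha> v else 0)"
    using assms by (intro sum.mono_neutral_left) auto
  finally show ?thesis .
qed

lemma realization_map_nonneg: "(\<And>v. 0 \<le> \<alpha> v) \<Longrightarrow> 0 \<le> realization_map f \<alpha> w"
  unfolding realization_map_def by (simp add: sum_nonneg)

lemma realization_map_support:
  assumes "realization_map f \<alpha> w \<noteq> 0"
  obtains v where "\<alpha> v \<noteq> 0" "f v = w"
  using assms unfolding realization_map_def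
  by (auto elim: sum.not_neutral_contains_not_neutral)

lemma sum_realization_map:
  assumes "finite V" "finite W" "\<And>v. v \<notin> V \<Longrightarrow> \<alpha> v = 0" "f ` V \<subseteq> W"
  shows "sum (realization_map f \<alpha>) W = sum \<alpha> V"
proof -
  have "sum (realization_map f \<alpha>) W = (\<Sum>w\<in>W. \<Sum>v\<in>V. if f v = w then \<alpha> v else 0)"
    using realization_map_eq_sum[where V = V and \<alpha> = \<alpha> and f = f, OF assms(1,3)] by simp
  also have "\<dots> = (\<Sum>v\<in>V. \<Sum>w\<in>W. if f v = w then \<alpha> v else 0)"
    by (rule sum.swap)
  also have "\<dots> = sum \<alpha> V"
    using assms by (intro sum.cong) auto
  finally show ?thesis .
qed

lemma realization_map_comp:
  assumes "finite V" "finite W" "\<And>v. v \<notin> V \<Longrightarrow> \<alpha> v = 0" "f ` V \<subseteq> W"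
  shows "realization_map g (realization_map f \<alpha>) = realization_map (g \<circ> f) \<alpha>"
proof
  fix u
  have supp: "realization_map f \<alpha> w = 0" if "w \<notin> W" for w
    using assms(3,4) that by (auto elim: realization_map_support)
  have "realization_map g (realization_map f \<alpha>) u =
      (\<Sum>w\<in>W. if g w = u then realization_map f \<alpha> w else 0)"
    using assms(2) supp by (rule realization_map_eq_sum)
  also have "\<dots> = (\<Sum>w\<in>W. \<Sum>v\<in>V. if g w = u then if f v = w then \<alpha> v else 0 else 0)"
    using realization_map_eq_sum[where V = V and \<alpha> = \<alpha> and f = f, OF assms(1,3)]
    by (intro sum.cong) auto
  also have "\<dots> = (\<Sum>v\<in>V. \<Sum>w\<in>W. if g w = u then if f v = w then \<alpha> v else 0 else 0)"
    by (rule sum.swap)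
  also have "\<dots> = (\<Sum>v\<in>V. \<Sum>w\<in>W. if f v = w then if g (f v) = u then \<alpha> v else 0 else 0)"
    by (intro sum.cong) auto
  also have "\<dots> = (\<Sum>v\<in>V. if g (f v) = u then \<alpha> v else 0)"
    using assms by (intro sum.cong) auto
  also have "\<dots> = realization_map (g \<circ> f) \<alpha> u"
    using realization_map_eq_sum[where V = V and \<alpha> = \<alpha> and f = "g \<circ> f", OF assms(1,3)] by simp
  finally show "realization_map g (realization_map f \<alpha>) u = realization_map (g \<circ> f) \<alpha> u" .
qed

lemma continuous_on_realization_map:
  assumes "finite V" "continuous_on T g" "\<And>x v. x \<in> T \<Longrightarrow> v \<notin> V \<Longrightarrow> g x v = 0"
  shows "continuous_on T (\<lambda>x. realization_map f (g x))"
proof -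
  have coord: "continuous_on T (\<lambda>x. g x v)" for v
    by (rule continuous_on_compose2[OF continuous_on_product_coordinates assms(2)]) auto
  have "continuous_on T (\<lambda>x w. \<Sum>v\<in>V. if f v = w then g x v else 0)"
  proof (intro continuous_intros)
    show "continuous_on T (\<lambda>x. if f v = w then g x v else 0)" for v w
      using coord by (cases "f v = w") auto
  qed
  moreover have "(\<lambda>w. \<Sum>v\<in>V. if f v = w then g x v else 0) = realization_map f (g x)"
    if "x \<in> T" for x
    by (rule ext, rule sym, rule realization_map_eq_sum) (use assms that in auto)
  ultimately show ?thesis
    by (rule continuous_on_eq)
qed

lemma realization_map_chain_points:
  assumes "finite V" "finite W" "f ` V \<subseteq> W" "mono_on V f" "\<alpha> \<in> chain_points V"
  shows "realization_map f \<alpha> \<in> chain_points W"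
proof -
  note \<alpha> = chain_weightsD[OF chain_points_weights[OF assms(5)]]
  have "sum (realization_map f \<alpha>) W = 1"
    using sum_realization_map[OF assms(1,2) \<alpha>(2) assms(3)] chain_points_sum[OF assms(5)] by simp
  moreover have "v \<le> w \<or> w \<le> v" if nz: "realization_map f \<alpha> v \<noteq> 0" "realization_map f \<alpha> w \<noteq> 0" for v w
  proof -
    obtain a where a: "\<alpha> a \<noteq> 0" "f a = v"
      using nz(1) by (rule realization_map_support)
    obtain b where b: "\<alpha> b \<noteq> 0" "f b = w"
      using nz(2) by (rule realization_map_support)
    show ?thesis
      using \<alpha>(4)[OF a(1) b(1)]
    proof
      assume "a \<le> b"
      then show ?thesis using monotone_onD[OF assms(4) \<alpha>(3)[OF a(1)] \<alpha>(3)[OF b(1)]] a b by simp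
    next
      assume "b \<le> a"
      then show ?thesis using monotone_onD[OF assms(4) \<alpha>(3)[OF b(1)] \<alpha>(3)[OF a(1)]] a b by simp
    qed
  qed
  moreover have "realization_map f \<alpha> v = 0" if "v \<notin> W" for v
    using that \<alpha>(3) assms(3) by (auto elim: realization_map_support)
  ultimately show ?thesis
    using realization_map_nonneg[of \<alpha> f, OF \<alpha>(1)]
    unfolding chain_points_def chain_weights_def by blast
qed

section \<open>Contracting along a decreasing map\<close>

text \<open>
  The part of \<open>\<alpha>\<close> consisting of the mass \<open>s\<close> at the bottom of its supporting chain. Moving only
  this part along a decreasing map \<open>\<rho>\<close> keeps the support a chain, which the affine homotopy
  from \<open>\<alpha>\<close> to its image under \<open>\<rho>\<close> does not.
\<close>

definition lower_part :: "'v::order set \<Rightarrow> real \<Rightarrow> ('v \<Rightarrow> real) \<Rightarrow> 'v \<Rightarrow> real" where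
  "lower_part V s \<alpha> v = min (sum \<alpha> {w \<in> V. w \<le> v}) s - min (sum \<alpha> {w \<in> V. w < v}) s"

definition slide :: "'v::order set \<Rightarrow> ('v \<Rightarrow> 'v) \<Rightarrow> real \<Rightarrow> ('v \<Rightarrow> real) \<Rightarrow> 'v \<Rightarrow> real" where
  "slide V \<rho> s \<alpha> v = realization_map \<rho> (lower_part V s \<alpha>) v + (\<alpha> v - lower_part V s \<alpha> v)"

lemma sum_atMost_eq_sum_lessThan:
  fixes \<alpha> :: "'v::order \<Rightarrow> real"
  assumes "finite V" "v \<in> V"
  shows "sum \<alpha> {w \<in> V. w \<le> v} = sum \<alpha> {w \<in> V. w < v} + \<alpha> v"
proof -
  have "{w \<in> V. w \<le> v} = insert v {w \<in> V. w < v}"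
    using assms by auto
  then show ?thesis using assms by simp
qed

text \<open>Truncating at \<open>s\<close> is monotone and 1-Lipschitz, so it turns the increment
  \<open>\<alpha> v\<close> of the cumulative mass into one between 0 and \<open>\<alpha> v\<close>.
  For \<open>v\<close> outside \<open>V\<close> the two cumulative sums coincide.\<close>

lemma lower_part_bounds:
  assumes "finite V" "\<alpha> \<in> chain_weights V"
  shows "0 \<le> lower_part V s \<alpha> v" "lower_part V s \<alpha> v \<le> \<alpha> v"
proof -
  note \<alpha> = chain_weightsD[OF assms(2)]
  have "0 \<le> lower_part V s \<alpha> v \<and> lower_part V s \<alpha> v \<le> \<alpha> v"
  proof (cases "v \<in> V")
    case True
    then show ?thesis
      using \<alpha>(1)[of v] by (auto simp: lower_part_def sum_atMost_eq_sum_lessThan[OF assms(1)] min_def)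
  next
    case False
    then have "{w \<in> V. w \<le> v} = {w \<in> V. w < v}"
      by (auto simp: order.order_iff_strict)
    then show ?thesis using False \<alpha>(2) by (simp add: lower_part_def)
  qed
  then show "0 \<le> lower_part V s \<alpha> v" "lower_part V s \<alpha> v \<le> \<alpha> v" by auto
qed

lemma lower_part_support:
  assumes "finite V" "\<alpha> \<in> chain_weights V" "lower_part V s \<alpha> v \<noteq> 0"
  shows "\<alpha> v \<noteq> 0"
  using lower_part_bounds[OF assms(1,2), of s v] assms(3) by linarith

text \<open>Something is taken from \<open>v\<close> only if the mass strictly below
  \<open>v\<close> is less than \<open>s\<close>; something is left at \<open>w\<close> only if the
  mass up to \<open>w\<close> exceeds \<open>s\<close>. For \<open>w < v\<close> the latter mass is
  at most the former, a contradiction.\<close>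

lemma lower_part_le:
  assumes "finite V" "\<alpha> \<in> chain_weights V"
    and "lower_part V s \<alpha> v \<noteq> 0" "lower_part V s \<alpha> w \<noteq> \<alpha> w" "\<alpha> w \<noteq> 0"
  shows "v \<le> w"
proof (rule ccontr)
  assume "\<not> v \<le> w"
  note \<alpha> = chain_weightsD[OF assms(2)]
  have v: "\<alpha> v \<noteq> 0"
    using lower_part_support assms by blast
  have "w < v"
    using \<alpha>(4)[OF v assms(5)] \<open>\<not> v \<le> w\<close> by auto
  have "sum \<alpha> {u \<in> V. u \<le> w} \<le> sum \<alpha> {u \<in> V. u < v}"
    using assms(1) \<alpha>(1) \<open>w < v\<close> by (intro sum_mono2) auto
  moreover have "sum \<alpha> {u \<in> V. u < v} < s"
    using assms(3) \<alpha>(1)[of v]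
    unfolding lower_part_def sum_atMost_eq_sum_lessThan[OF assms(1) \<alpha>(3)[OF v]]
    by (auto simp: min_def split: if_splits)
  moreover have "s < sum \<alpha> {u \<in> V. u \<le> w}"
    using assms(4) \<alpha>(1)[of w]
    unfolding lower_part_def sum_atMost_eq_sum_lessThan[OF assms(1) \<alpha>(3)[OF assms(5)]]
    by (auto simp: min_def split: if_splits)
  ultimately show False by linarith
qed

lemma slide_0:
  assumes "finite V" "\<alpha> \<in> chain_points V"
  shows "slide V \<rho> 0 \<alpha> = \<alpha>"
proof -
  have "lower_part V 0 \<alpha> = (\<lambda>_. 0)"
    using chain_weightsD(1)[OF chain_points_weights[OF assms(2)]]
    by (simp add: lower_part_def fun_eq_iff min_absorb2 sum_nonneg)
  then show ?thesis
    by (intro ext) (simp add: slide_def realization_map_def)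
qed

lemma slide_1:
  assumes "finite V" "\<alpha> \<in> chain_points V"
  shows "slide V \<rho> 1 \<alpha> = realization_map \<rho> \<alpha>"
proof -
  note \<alpha> = chain_weightsD[OF chain_points_weights[OF assms(2)]]
  have le: "sum \<alpha> A \<le> 1" if "A \<subseteq> V" for A
    using sum_mono2[OF assms(1) that, of \<alpha>] \<alpha>(1) chain_points_sum[OF assms(2)] by simp
  have "lower_part V 1 \<alpha> v = \<alpha> v" for v
  proof (cases "v \<in> V")
    case True
    have "min (sum \<alpha> {w \<in> V. w \<le> v}) 1 = sum \<alpha> {w \<in> V. w \<le> v}"
      "min (sum \<alpha> {w \<in> V. w < v}) 1 = sum \<alpha> {w \<in> V. w < v}"
      by (intro min_absorb1 le; auto)+
    then show ?thesis
      using sum_atMost_eq_sum_lessThan[OF assms(1) True, of \<alpha>] by (simp add: lower_part_def)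
  next
    case False
    then show ?thesis
      using lower_part_bounds[OF assms(1) chain_points_weights[OF assms(2)], of 1 v] \<alpha>(2)[OF False]
      by simp
  qed
  then have "lower_part V 1 \<alpha> = \<alpha>" by blast
  then show ?thesis
    by (intro ext) (simp add: slide_def)
qed

lemma slide_support:
  assumes "finite V" "\<alpha> \<in> chain_weights V" "slide V \<rho> s \<alpha> w \<noteq> 0"
  obtains (moved) v where "lower_part V s \<alpha> v \<noteq> 0" "w = \<rho> v"
    | (fixed) "lower_part V s \<alpha> w \<noteq> \<alpha> w"
proof (cases "realization_map \<rho> (lower_part V s \<alpha>) w = 0")
  case True
  then show ?thesis using assms(3) fixed by (simp add: slide_def)
next
  case False
  then show ?thesis by (rule realization_map_support) (use moved in blast)
qed

text \<open>Moved vertices are comparable as monotone images of a chain, unmoved ones belong to the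
  old chain, and in the mixed case \<open>\<rho> v \<le> v \<le> w\<close> by
  \<open>lower_part_le\<close>: only the bottom of the chain is moved, and it is moved down.\<close>

lemma slide_chain_points:
  assumes "finite V" "\<rho> ` V \<subseteq> V" "mono_on V \<rho>" "\<And>v. v \<in> V \<Longrightarrow> \<rho> v \<le> v"
    and "\<alpha> \<in> chain_points V"
  shows "slide V \<rho> s \<alpha> \<in> chain_points V"
proof -
  note w\<alpha> = chain_points_weights[OF assms(5)]
  note \<alpha> = chain_weightsD[OF w\<alpha>]
  note bounds = lower_part_bounds[OF assms(1) w\<alpha>]
  have supp: "lower_part V s \<alpha> v = 0" if "v \<notin> V" for v
    using bounds[of s v] \<alpha>(2)[OF that] by simp
  have "sum (slide V \<rho> s \<alpha>) V
      = sum (realization_map \<rho> (lower_part V s \<alpha>)) V + (sum \<alpha> V - sum (lower_part V s \<alpha>) V)"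
    by (simp add: slide_def[abs_def] sum.distrib sum_subtractf)
  also have "\<dots> = 1"
    using sum_realization_map[OF assms(1,1) supp assms(2)] chain_points_sum[OF assms(5)] by simp
  finally have sum: "sum (slide V \<rho> s \<alpha>) V = 1" .
  have nonneg: "0 \<le> slide V \<rho> s \<alpha> v" for v
    unfolding slide_def
    using realization_map_nonneg[of "lower_part V s \<alpha>" \<rho> v, OF bounds(1)] bounds(2)[of s v] by simp
  have origin: "\<alpha> v \<noteq> 0 \<and> v \<in> V" if "lower_part V s \<alpha> v \<noteq> 0" for v
    using lower_part_support[OF assms(1) w\<alpha> that] \<alpha>(3) by blast
  have fixed: "\<alpha> v \<noteq> 0" if "lower_part V s \<alpha> v \<noteq> \<alpha> v" for v
    using bounds[of s v] that by linarith
  have outside: "slide V \<rho> s \<alpha> v = 0" if "v \<notin> V" for v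
  proof (rule ccontr)
    assume "slide V \<rho> s \<alpha> v \<noteq> 0"
    with assms(1) w\<alpha> show False
      by (cases rule: slide_support) (use that assms(2) origin \<alpha>(3) fixed in auto)
  qed
  have \<rho>_comparable: "\<rho> v \<le> \<rho> w \<or> \<rho> w \<le> \<rho> v" if "\<alpha> v \<noteq> 0" "\<alpha> w \<noteq> 0" for v w
    using \<alpha>(4)[OF that] \<alpha>(3)[OF that(1)] \<alpha>(3)[OF that(2)] monotone_onD[OF assms(3)] by blast
  have \<rho>_below: "\<rho> v \<le> w" if "lower_part V s \<alpha> v \<noteq> 0" "lower_part V s \<alpha> w \<noteq> \<alpha> w" for v w
    using lower_part_le[OF assms(1) w\<alpha> that fixed[OF that(2)]] assms(4)[of v] origin[OF that(1)]
    by (metis order.trans)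
  have "v \<le> w \<or> w \<le> v" if v: "slide V \<rho> s \<alpha> v \<noteq> 0" and w: "slide V \<rho> s \<alpha> w \<noteq> 0" for v w
    using assms(1) w\<alpha> v
  proof (cases rule: slide_support)
    case v: (moved v')
    from assms(1) w\<alpha> w show ?thesis
      by (cases rule: slide_support) (use v \<rho>_comparable \<rho>_below origin in auto)
  next
    case v: fixed
    from assms(1) w\<alpha> w show ?thesis
      by (cases rule: slide_support) (use v \<rho>_below \<alpha>(4)[OF fixed fixed] in auto)
  qed
  then show ?thesis
    using sum nonneg outside unfolding chain_points_def chain_weights_def by blast
qed

lemma continuous_on_slide:
  assumes "finite V"
  shows "continuous_on ({0..1} \<times> chain_points V) (\<lambda>(s, \<alpha>). slide V \<rho> s \<alpha>)"
proof -
  let ?X = "{0..1} \<times> chain_points V"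
  have coord: "continuous_on ?X (\<lambda>p. snd p v)" for v
    by (rule continuous_on_compose2[OF continuous_on_product_coordinates continuous_on_snd])
      (auto intro: continuous_on_id)
  have low: "continuous_on ?X (\<lambda>p. lower_part V (fst p) (snd p) v)" for v
    unfolding lower_part_def by (intro continuous_intros coord)
  have "continuous_on ?X (\<lambda>p. realization_map \<rho> (lower_part V (fst p) (snd p)))"
  proof (rule continuous_on_realization_map[OF assms])
    show "continuous_on ?X (\<lambda>p. lower_part V (fst p) (snd p))"
      by (intro continuous_on_coordinatewise_then_product low)
    show "lower_part V (fst p) (snd p) v = 0" if "p \<in> ?X" "v \<notin> V" for p v
      using lower_part_bounds[OF assms chain_points_weights, of "snd p" "fst p" v]
        chain_weightsD(2)[OF chain_points_weights, of "snd p" V v] that by auto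
  qed
  then have "continuous_on ?X (\<lambda>p. realization_map \<rho> (lower_part V (fst p) (snd p)) v)" for v
    by (rule continuous_on_compose2[OF continuous_on_product_coordinates]) auto
  then have "continuous_on ?X (\<lambda>p. slide V \<rho> (fst p) (snd p) v)" for v
    unfolding slide_def by (intro continuous_intros coord low)
  then show ?thesis
    by (simp add: case_prod_unfold continuous_on_coordinatewise_then_product)
qed

section \<open>Contractions obtained from a contractible poset\<close>

lemma contractible_posetE:
  assumes "finite S" "contractible_poset S"
  obtains H c where "continuous_on ({0..1} \<times> chain_points S) H"
    "\<And>s \<alpha>. s \<in> {0..1} \<Longrightarrow> \<alpha> \<in> chain_points S \<Longrightarrow> H (s, \<alpha>) \<in> chain_points S"
    "\<And>\<alpha>. \<alpha> \<in> chain_points S \<Longrightarrow> H (0, \<alpha>) = \<alpha>"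
    "\<And>\<alpha>. \<alpha> \<in> chain_points S \<Longrightarrow> H (1::real, \<alpha>) = c" "c \<in> chain_points S"
proof -
  obtain p where p: "p \<in> S"
    using assms(2) by (auto simp: contractible_poset_def)
  \<comment> \<open>A vertex as a point of the realization: evaluating the last stage of the
    homotopy there shows that \<open>c\<close> belongs to the realization.\<close>
  have p_in: "(\<lambda>v. if v = p then 1 else 0) \<in> chain_points S"
    using assms(1) p by (auto simp: chain_points_def chain_weights_def)
  obtain c where "homotopic_with (\<lambda>_. True) (top_of_set (chain_points S))
      (top_of_set (chain_points S)) id (\<lambda>_. c)"
    using assms(2)
    unfolding contractible_poset_def contractible_space_def
      geometric_realization_order_complex[OF assms(1)] by blast
  then obtain H where H: "continuous_on ({0..1} \<times> chain_points S) H"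
    "\<And>s \<alpha>. s \<in> {0..1} \<Longrightarrow> \<alpha> \<in> chain_points S \<Longrightarrow> H (s, \<alpha>) \<in> chain_points S"
    "\<And>\<alpha>. H (0::real, \<alpha>) = \<alpha>" "\<And>\<alpha>. H (1, \<alpha>) = c"
    unfolding homotopic_with_def by (auto simp: Pi_iff)
  have "c \<in> chain_points S"
    using H(2)[OF _ p_in, of 1] H(4) by simp
  with H show ?thesis
    by (intro that[of H c]) auto
qed

lemma contraction_through_contractible:
  fixes V :: "'v::order set" and S :: "'w::order set"
  assumes "finite V" "finite S" "contractible_poset S"
    and r: "r ` V \<subseteq> S" "mono_on V r" and i: "i ` S \<subseteq> V" "mono_on S i"
    and le: "\<And>v. v \<in> V \<Longrightarrow> i (r v) \<le> v"
  obtains \<Phi> c where "continuous_on ({0..1} \<times> chain_points V) \<Phi>"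
    "\<And>s \<alpha>. s \<in> {0..1} \<Longrightarrow> \<alpha> \<in> chain_points V \<Longrightarrow> \<Phi> (s, \<alpha>) \<in> chain_points V"
    "\<And>\<alpha>. \<alpha> \<in> chain_points V \<Longrightarrow> \<Phi> (0, \<alpha>) = \<alpha>"
    "\<And>\<alpha>. \<alpha> \<in> chain_points V \<Longrightarrow> \<Phi> (1::real, \<alpha>) = c"
    "\<And>s \<alpha> v. \<alpha> \<in> chain_points V \<Longrightarrow> s \<in> {0..1} \<Longrightarrow> \<Phi> (s, \<alpha>) v \<noteq> 0 \<Longrightarrow> v \<notin> i ` S \<Longrightarrow> \<alpha> v \<noteq> 0"
    "c \<in> chain_points V" "\<And>v. c v \<noteq> 0 \<Longrightarrow> v \<in> i ` S"
proof -
  obtain H c where H: "continuous_on ({0..1} \<times> chain_points S) H"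
    "\<And>s \<alpha>. s \<in> {0..1} \<Longrightarrow> \<alpha> \<in> chain_points S \<Longrightarrow> H (s, \<alpha>) \<in> chain_points S"
    "\<And>\<alpha>. \<alpha> \<in> chain_points S \<Longrightarrow> H (0, \<alpha>) = \<alpha>"
    "\<And>\<alpha>. \<alpha> \<in> chain_points S \<Longrightarrow> H (1::real, \<alpha>) = c" "c \<in> chain_points S"
    using contractible_posetE[OF assms(2,3)] by metis
  let ?r = "realization_map r" and ?i = "realization_map i"
  let ?\<Phi> = "\<lambda>p. if fst p \<le> 1/2 then slide V (i \<circ> r) (2 * fst p) (snd p)
    else ?i (H (2 * fst p - 1, ?r (snd p)))"
  have r_in: "?r \<alpha> \<in> chain_points S" if "\<alpha> \<in> chain_points V" for \<alpha>
    using realization_map_chain_points[OF assms(1,2) r that] .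
  have i_in: "?i \<alpha> \<in> chain_points V" if "\<alpha> \<in> chain_points S" for \<alpha>
    using realization_map_chain_points[OF assms(2,1) i that] .
  have ir: "?i (?r \<alpha>) = realization_map (i \<circ> r) \<alpha>" if "\<alpha> \<in> chain_points V" for \<alpha>
    using realization_map_comp[OF assms(1,2) chain_weightsD(2)[OF chain_points_weights[OF that]] r(1)] .
  have \<rho>: "(i \<circ> r) ` V \<subseteq> V" "mono_on V (i \<circ> r)"
    using r i by (auto simp: monotone_on_def image_subset_iff)
  have i_supp: "v \<in> i ` S" if "?i \<alpha> v \<noteq> 0" "\<alpha> \<in> chain_points S" for \<alpha> v
    using that(1) by (rule realization_map_support)
      (use chain_weightsD(3)[OF chain_points_weights[OF that(2)]] in blast)
  have "continuous_on ({0..1} \<times> chain_points V) ?\<Phi>"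
  proof (rule continuous_on_cases_le)
    show "continuous_on {p \<in> {0..1::real} \<times> chain_points V. fst p \<le> 1/2}
        (\<lambda>p. slide V (i \<circ> r) (2 * fst p) (snd p))"
    proof -
      have "continuous_on {p \<in> {0..1::real} \<times> chain_points V. fst p \<le> 1/2} (\<lambda>p. (2 * fst p :: real, snd p))"
        by (intro continuous_on_Pair continuous_on_mult continuous_on_const continuous_on_fst
            continuous_on_snd continuous_on_id)
      from continuous_on_compose2[OF continuous_on_slide[OF assms(1), of "i \<circ> r"] this]
      show ?thesis by fastforce
    qed
    have "continuous_on {p \<in> {0..1::real} \<times> chain_points V. 1/2 \<le> fst p} (\<lambda>p. ?r (snd p))"
      by (rule continuous_on_realization_map[OF assms(1) continuous_on_snd[OF continuous_on_id]])
        (use chain_weightsD(2)[OF chain_points_weights] in auto)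
    then have "continuous_on {p \<in> {0..1::real} \<times> chain_points V. 1/2 \<le> fst p}
        (\<lambda>p. (2 * fst p - 1, ?r (snd p)))"
      by (rule continuous_on_Pair[rotated]) (intro continuous_intros)
    then have "continuous_on {p \<in> {0..1::real} \<times> chain_points V. 1/2 \<le> fst p}
        (\<lambda>p. H (2 * fst p - 1, ?r (snd p)))"
      by (rule continuous_on_compose2[OF H(1)]) (auto intro: r_in)
    then show "continuous_on {p \<in> {0..1::real} \<times> chain_points V. 1/2 \<le> fst p}
        (\<lambda>p. ?i (H (2 * fst p - 1, ?r (snd p))))"
    proof (rule continuous_on_realization_map[OF assms(2)])
      fix p :: "real \<times> ('v \<Rightarrow> real)" and v
      assume p: "p \<in> {p \<in> {0..1::real} \<times> chain_points V. 1/2 \<le> fst p}" and v: "v \<notin> S"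
      then have "H (2 * fst p - 1, ?r (snd p)) \<in> chain_points S"
        by (intro H(2) r_in) auto
      with v show "H (2 * fst p - 1, ?r (snd p)) v = 0"
        using chain_weightsD(2)[OF chain_points_weights] by blast
    qed
    show "continuous_on ({0..1} \<times> chain_points V) fst"
      by (intro continuous_intros)
    show "slide V (i \<circ> r) (2 * fst p) (snd p) = ?i (H (2 * fst p - 1, ?r (snd p)))"
      if p: "p \<in> {0..1} \<times> chain_points V" "fst p = 1/2" for p
    proof -
      obtain \<alpha> where "p = (1/2, \<alpha>)" "\<alpha> \<in> chain_points V"
        using p by (cases p) auto
      then show ?thesis
        by (simp add: slide_1[OF assms(1)] H(3) r_in ir)
    qed
  qed
  moreover have "?\<Phi> (s, \<alpha>) \<in> chain_points V" if "s \<in> {0..1}" "\<alpha> \<in> chain_points V" for s \<alpha>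
  proof (cases "s \<le> 1/2")
    case True
    then show ?thesis
      using slide_chain_points[OF assms(1) \<rho> _ that(2)] le by simp
  next
    case False
    then have "?i (H (2 * s - 1, ?r \<alpha>)) \<in> chain_points V"
      using that by (intro i_in H(2) r_in) auto
    with False show ?thesis by simp
  qed
  moreover have "?\<Phi> (0, \<alpha>) = \<alpha>" "?\<Phi> (1, \<alpha>) = ?i c" if "\<alpha> \<in> chain_points V" for \<alpha>
    using slide_0[OF assms(1) that] H(4) r_in[OF that] by auto
  moreover have "\<alpha> v \<noteq> 0"
    if \<alpha>: "\<alpha> \<in> chain_points V" "s \<in> {0..1}" "?\<Phi> (s, \<alpha>) v \<noteq> 0" "v \<notin> i ` S" for s \<alpha> v
  proof (cases "s \<le> 1/2")
    case True
    then have "slide V (i \<circ> r) (2 * s) \<alpha> v \<noteq> 0" using \<alpha>(3) by simp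
    with assms(1) chain_points_weights[OF \<alpha>(1)] show ?thesis
    \<comment> \<open>Moved mass lands in the image of \<open>i\<close>, which excludes
      \<open>v\<close>; unmoved mass was at \<open>v\<close> from the start.\<close>
    proof (cases rule: slide_support)
      case (moved w)
      then have "w \<in> V"
        using lower_part_support[OF assms(1)] chain_weightsD(3) chain_points_weights[OF \<alpha>(1)] by metis
      then show ?thesis using moved \<alpha>(4) r(1) by auto
    next
      case fixed
      then show ?thesis
        using lower_part_bounds[OF assms(1) chain_points_weights[OF \<alpha>(1)], of "2 * s" v] by linarith
    qed
  next
    case False
    then have "?i (H (2 * s - 1, ?r \<alpha>)) v \<noteq> 0" "H (2 * s - 1, ?r \<alpha>) \<in> chain_points S"
      using \<alpha> by (auto intro: H(2) r_in)
    then show ?thesis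
      using i_supp \<alpha>(4) by blast
  qed
  ultimately show ?thesis
    by (rule that[OF _ _ _ _ _ i_in[OF H(5)] i_supp[OF _ H(5)]])
qed

section \<open>Coordinates on the suspension\<close>

lemma susp_proj_in_susp_points:
  assumes "x \<in> A" "-1 \<le> t" "t \<le> 1"
  shows "susp_proj (x, t) \<in> susp_points A"
proof -
  have "-1 < t \<and> t < 1" if "t \<noteq> 1" "t \<noteq> -1"
    using assms that by linarith
  then show ?thesis
    using assms(1) by (simp add: susp_proj_def susp_points_def)
qed

lemma continuous_map_susp_proj:
  "continuous_map (prod_topology X (top_of_set {-1..1})) (suspension X) susp_proj"
  unfolding continuous_map_def topspace_suspension
  using susp_proj_in_susp_points
  by (force simp: suspension_def openin_final_topology)

text \<open>The universal property of the final topology. For empty \<open>X\<close> the poles are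
  not in the image of \<open>susp_proj\<close>, so their images are controlled by the second
  hypothesis.\<close>

lemma continuous_map_suspension:
  assumes "continuous_map (prod_topology X (top_of_set {-1..1})) Z (h \<circ> susp_proj)"
    and "h ` susp_points (topspace X) \<subseteq> topspace Z"
  shows "continuous_map (suspension X) Z h"
  unfolding continuous_map_def topspace_suspension
proof (intro conjI allI impI)
  show "h \<in> susp_points (topspace X) \<rightarrow> topspace Z"
    using assms(2) by auto
  fix U assume U: "openin Z U"
  have "{x \<in> topspace (prod_topology X (top_of_set {-1..1})).
        susp_proj x \<in> {y \<in> susp_points (topspace X). h y \<in> U}}
      = {x \<in> topspace (prod_topology X (top_of_set {-1..1})). (h \<circ> susp_proj) x \<in> U}"
    using susp_proj_in_susp_points by fastforce
  then show "openin (suspension X) {y \<in> susp_points (topspace X). h y \<in> U}"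
    using openin_continuous_map_preimage[OF assms(1) U]
    by (auto simp: suspension_def openin_final_topology)
qed

text \<open>The compact cylinder covers the suspension only for nonempty \<open>X\<close>; adding
  the finite set of poles treats the empty case at the same time.\<close>

lemma compact_space_suspension:
  assumes "compact_space X"
  shows "compact_space (suspension X)"
proof -
  let ?XI = "prod_topology X (top_of_set {-1..1::real})"
  have "compact_space (top_of_set {-1..1::real})"
    by (simp add: compact_space_subtopology)
  then have "compact_space ?XI"
    using assms by (simp add: compact_space_prod_topology)
  then have "compactin (suspension X) (susp_proj ` topspace ?XI)"
    using image_compactin[OF _ continuous_map_susp_proj] unfolding compact_space_def by blast
  moreover have "compactin (suspension X) {North, South}"
    by (rule finite_imp_compactin) (auto simp: topspace_suspension susp_points_def)
  ultimately have "compactin (suspension X) (susp_proj ` topspace ?XI \<union> {North, South})"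
    by (rule compactin_Un)
  moreover have "susp_proj ` topspace ?XI \<union> {North, South} = topspace (suspension X)"
  proof
    show "susp_proj ` topspace ?XI \<union> {North, South} \<subseteq> topspace (suspension X)"
      by (auto simp: topspace_suspension susp_points_def susp_proj_def)
    have "Level x t \<in> susp_proj ` topspace ?XI" if "x \<in> topspace X" "-1 < t" "t < 1" for x t
      using that by (intro image_eqI[of _ _ "(x, t)"]) (auto simp: susp_proj_def)
    then show "topspace (suspension X) \<subseteq> susp_proj ` topspace ?XI \<union> {North, South}"
      by (auto simp: topspace_suspension susp_points_def)
  qed
  ultimately show ?thesis by (simp add: compact_space_def)
qed

text \<open>
  A point \<open>Level x t\<close> is represented by \<open>((1 - \<bar>t\<bar>) x, t)\<close>: scaling \<open>x\<close> makes the coordinates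
  continuous at the poles.
\<close>

definition chain_suspension :: "'v::order set \<Rightarrow> (('v \<Rightarrow> real) \<times> real) set" where
  "chain_suspension V = {(y, t). y \<in> chain_weights V \<and> \<bar>t\<bar> + sum y V = 1}"

fun susp_coords :: "('v \<Rightarrow> real) susp \<Rightarrow> ('v \<Rightarrow> real) \<times> real" where
  "susp_coords North = ((\<lambda>_. 0), 1)"
| "susp_coords South = ((\<lambda>_. 0), - 1)"
| "susp_coords (Level x t) = ((\<lambda>v. (1 - \<bar>t\<bar>) * x v), t)"

lemma chain_weights_scale:
  assumes "\<alpha> \<in> chain_weights V" "0 \<le> c"
  shows "(\<lambda>v. c * \<alpha> v) \<in> chain_weights V"
  by (rule chain_weights_mono[OF assms(1)]) (use assms chain_weightsD(1)[OF assms(1)] in auto)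

lemma chain_points_normalize:
  assumes "y \<in> chain_weights V" "sum y V \<noteq> 0"
  shows "(\<lambda>v. y v / sum y V) \<in> chain_points V"
proof -
  have "0 \<le> inverse (sum y V)"
    using chain_weightsD(1)[OF assms(1)] by (simp add: sum_nonneg)
  from chain_weights_scale[OF assms(1) this] show ?thesis
    using assms(2)
    by (simp add: chain_points_def divide_inverse mult.commute[of _ "inverse (sum y V)"]
        flip: sum_distrib_left)
qed

lemma Hausdorff_space_fun_prod:
  "Hausdorff_space (top_of_set (A :: (('v \<Rightarrow> real) \<times> real) set))"
proof (rule Hausdorff_space_subtopology)
  have "Hausdorff_space (euclidean :: ('v \<Rightarrow> real) topology)"
    unfolding euclidean_product_topology[symmetric]
    by (simp add: Hausdorff_space_product_topology)
  then show "Hausdorff_space (euclidean :: (('v \<Rightarrow> real) \<times> real) topology)"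
    by (simp add: Hausdorff_space_prod_topology flip: prod_topology_euclidean)
qed

text \<open>A continuous bijection from a compact space to a Hausdorff space. The inverse, which
  divides by 1 - |t|, thus needs no argument at the poles.\<close>

lemma homeomorphic_map_susp_coords:
  fixes V :: "'v::order set"
  assumes "finite V"
  shows "homeomorphic_map (suspension (top_of_set (chain_points V)))
    (top_of_set (chain_suspension V)) susp_coords"
proof (rule continuous_imp_homeomorphic_map)
  have in_susp: "(\<lambda>v. (1 - \<bar>t\<bar>) * x v, t) \<in> chain_suspension V"
    if "x \<in> chain_points V" "-1 \<le> t" "t \<le> 1" for x and t :: real
    using that chain_weights_scale[OF chain_points_weights[OF that(1)], of "1 - \<bar>t\<bar>"]
    by (auto simp: chain_suspension_def chain_points_sum simp flip: sum_distrib_left)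
  have poles: "(\<lambda>_. 0, t) \<in> chain_suspension V" if "\<bar>t\<bar> = 1" for t
    using that by (simp add: chain_suspension_def chain_weights_def)
  have img: "susp_coords ` susp_points (chain_points V) \<subseteq> chain_suspension V"
    using in_susp poles by (auto simp: susp_points_def)
  show "continuous_map (suspension (top_of_set (chain_points V)))
    (top_of_set (chain_suspension V)) susp_coords"
  proof (rule continuous_map_suspension)
    let ?D = "chain_points V \<times> {-1..1::real}"
    have "continuous_on ?D (\<lambda>p. fst p v)" for v
      by (rule continuous_on_compose2[OF continuous_on_product_coordinates
            continuous_on_fst[OF continuous_on_id]]) auto
    then have "continuous_on ?D (\<lambda>p. ((\<lambda>v. (1 - \<bar>snd p\<bar>) * fst p v), snd p))"
      by (intro continuous_on_Pair continuous_on_coordinatewise_then_product continuous_intros)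
    then have "continuous_on ?D (susp_coords \<circ> susp_proj)"
      by (rule continuous_on_eq) (auto simp: susp_proj_def)
    moreover have "(susp_coords \<circ> susp_proj) \<in> ?D \<rightarrow> chain_suspension V"
      using in_susp poles by (auto simp: susp_proj_def)
    ultimately show "continuous_map (prod_topology (top_of_set (chain_points V)) (top_of_set {-1..1}))
        (top_of_set (chain_suspension V)) (susp_coords \<circ> susp_proj)"
      by (simp del: o_apply comp_apply)
  qed (use img in simp)
  show "compact_space (suspension (top_of_set (chain_points V)))"
    using compact_chain_points[OF assms]
    by (intro compact_space_suspension) (simp add: compact_space_subtopology)
  show "Hausdorff_space (top_of_set (chain_suspension V))"
    by (rule Hausdorff_space_fun_prod)
  have "(y, t) \<in> susp_coords ` susp_points (chain_points V)" if "(y, t) \<in> chain_suspension V" for y t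
  proof -
    have y: "y \<in> chain_weights V" and t: "\<bar>t\<bar> + sum y V = 1"
      using that by (auto simp: chain_suspension_def)
    have nonneg: "0 \<le> sum y V"
      using chain_weightsD(1)[OF y] by (simp add: sum_nonneg)
    show ?thesis
    proof (cases "sum y V = 0")
      case True
      then have "y v = 0" for v
        using chain_weightsD(1,2)[OF y] assms by (cases "v \<in> V") (auto simp: sum_nonneg_eq_0_iff)
      then have "y = (\<lambda>_. 0)" by blast
      moreover have "t = 1 \<or> t = -1" using t True by auto
      ultimately have "(y, t) = susp_coords North \<or> (y, t) = susp_coords South" by auto
      then show ?thesis by (auto simp: susp_points_def)
    next
      case False
      then have "Level (\<lambda>v. y v / sum y V) t \<in> susp_points (chain_points V)"
        using chain_points_normalize[OF y False] t nonneg by (auto simp: susp_points_def)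
      moreover have "1 - \<bar>t\<bar> = sum y V" using t by simp
      then have "susp_coords (Level (\<lambda>v. y v / sum y V) t) = (y, t)"
        using False by simp
      ultimately show ?thesis by (metis imageI)
    qed
  qed
  with img show "susp_coords ` topspace (suspension (top_of_set (chain_points V)))
      = topspace (top_of_set (chain_suspension V))"
    by (auto simp: topspace_suspension)
  show "inj_on susp_coords (topspace (suspension (top_of_set (chain_points V))))"
    unfolding topspace_suspension
  proof (rule inj_onI)
    fix a b assume ab: "a \<in> susp_points (topspace (top_of_set (chain_points V)))"
      "b \<in> susp_points (topspace (top_of_set (chain_points V)))" "susp_coords a = susp_coords b"
    then show "a = b"
      by (cases a; cases b) (auto simp: susp_points_def fun_eq_iff)
  qed
qed

section \<open>Enriched sets of pairs\<close>

lemma comp_swap_chain_weights: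
  fixes V :: "('a::order \<times> 'a) set"
  assumes "\<alpha> \<in> chain_weights V" "prod.swap ` V \<subseteq> V"
  shows "\<alpha> \<circ> prod.swap \<in> chain_weights V"
proof -
  note \<alpha> = chain_weightsD[OF assms(1)]
  have "(\<alpha> \<circ> prod.swap) v = 0" if "v \<notin> V" for v
    using \<alpha>(2)[of "prod.swap v"] assms(2) that by (force simp: image_subset_iff)
  moreover have "v \<le> w \<or> w \<le> v" if "(\<alpha> \<circ> prod.swap) v \<noteq> 0" "(\<alpha> \<circ> prod.swap) w \<noteq> 0" for v w
    using \<alpha>(4)[of "prod.swap v" "prod.swap w"] that by (auto simp: less_eq_prod_def)
  moreover have "0 \<le> (\<alpha> \<circ> prod.swap) v" for v
    using \<alpha>(1) by simp
  ultimately show ?thesis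
    unfolding chain_weights_def by blast
qed

lemma sum_comp_swap:
  assumes "prod.swap ` V \<subseteq> V"
  shows "sum (\<alpha> \<circ> prod.swap) V = sum \<alpha> V"
  by (rule sum.reindex_bij_witness[of _ prod.swap prod.swap])
    (use assms in \<open>auto simp: image_subset_iff\<close>)

lemma comp_swap_chain_points:
  fixes V :: "('a::order \<times> 'a) set"
  assumes "\<alpha> \<in> chain_points V" "prod.swap ` V \<subseteq> V"
  shows "\<alpha> \<circ> prod.swap \<in> chain_points V"
  unfolding chain_points_def
  using comp_swap_chain_weights[OF chain_points_weights[OF assms(1)] assms(2)]
    trans[OF sum_comp_swap[OF assms(2)] chain_points_sum[OF assms(1)]] by blast

section \<open>Restriction of weights to B and extension by zero\<close>

definition restrict_weight :: "('a option \<times> 'a option \<Rightarrow> real) \<Rightarrow> 'a \<times> 'a \<Rightarrow> real" where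
  "restrict_weight \<alpha> = \<alpha> \<circ> map_prod Some Some"

definition extend_weight :: "('a \<times> 'a \<Rightarrow> real) \<Rightarrow> 'a option \<times> 'a option \<Rightarrow> real" where
  "extend_weight y w = (case w of (Some a, Some b) \<Rightarrow> y (a, b) | _ \<Rightarrow> 0)"

lemma restrict_weight_apply [simp]: "restrict_weight \<alpha> (a, b) = \<alpha> (Some a, Some b)"
  by (simp add: restrict_weight_def)

lemma extend_weight_simps [simp]:
  "extend_weight y (Some a, Some b) = y (a, b)"
  "extend_weight y (None, v) = 0" "extend_weight y (u, None) = 0"
  by (auto simp: extend_weight_def split: option.split)

lemma extend_weight_nonzero:
  assumes "extend_weight y w \<noteq> 0"
  obtains a b where "w = (Some a, Some b)" "y (a, b) \<noteq> 0"
  using assms by (auto simp: extend_weight_def split: prod.splits option.splits)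

lemma restrict_extend_weight [simp]: "restrict_weight (extend_weight y) = y"
  by auto

lemma restrict_weight_swap: "restrict_weight (\<alpha> \<circ> prod.swap) = restrict_weight \<alpha> \<circ> prod.swap"
  by auto

lemma extend_weight_swap: "extend_weight (y \<circ> prod.swap) = extend_weight y \<circ> prod.swap"
  by (auto simp: fun_eq_iff extend_weight_def split: option.splits)

text \<open>The involution of the suspension as seen through \<open>susp_coords\<close>.\<close>

definition susp_swap :: "('a \<times> 'a \<Rightarrow> real) \<times> real \<Rightarrow> ('a \<times> 'a \<Rightarrow> real) \<times> real" where
  "susp_swap z = (fst z \<circ> prod.swap, - snd z)"

lemma continuous_on_comp_swap: "continuous_on A (\<lambda>\<alpha> :: 'a \<times> 'b \<Rightarrow> real. \<alpha> \<circ> prod.swap)"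
  by (intro continuous_on_coordinatewise_then_product)
    (auto intro: continuous_on_subset[OF continuous_on_product_coordinates])

lemma Z2_space_comp_swap:
  fixes V :: "('a::order \<times> 'a) set"
  assumes "prod.swap ` V \<subseteq> V"
  shows "Z2_space (top_of_set (chain_points V)) (\<lambda>\<alpha>. \<alpha> \<circ> prod.swap)"
  using comp_swap_chain_points[OF _ assms] continuous_on_comp_swap
  by (auto simp: Z2_space_def fun_eq_iff)

lemma continuous_on_coord:
  assumes "continuous_on A f"
  shows "continuous_on A (\<lambda>x. f x v :: real)"
  by (rule continuous_on_compose2[OF continuous_on_product_coordinates assms]) auto

lemma Z2_space_susp_swap:
  fixes V :: "('a::order \<times> 'a) set"
  assumes "prod.swap ` V \<subseteq> V"
  shows "Z2_space (top_of_set (chain_suspension V)) susp_swap"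
proof -
  have "continuous_on (chain_suspension V) (\<lambda>z. (fst z \<circ> prod.swap, - snd z))"
    by (intro continuous_on_Pair continuous_on_minus continuous_on_snd continuous_on_id
        continuous_on_compose2[OF continuous_on_comp_swap[of UNIV] continuous_on_fst]) auto
  moreover have "susp_swap z \<in> chain_suspension V" if "z \<in> chain_suspension V" for z
    using that comp_swap_chain_weights[OF _ assms, of "fst z"] sum_comp_swap[OF assms, of "fst z"]
    unfolding chain_suspension_def susp_swap_def case_prod_unfold mem_Collect_eq
      fst_conv snd_conv abs_minus_cancel by metis
  ultimately show ?thesis
    by (auto simp: Z2_space_def susp_swap_def fun_eq_iff)
qed

locale enriched_pairs =
  fixes S :: "'a::order set" and B :: "('a \<times> 'a) set"
  assumes finite_S: "finite S" and B_subset: "B \<subseteq> S \<times> S" and swap_B: "prod.swap ` B \<subseteq> B"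
begin

definition left_part :: "('a option \<times> 'a option) set" where
  "left_part = map_prod Some Some ` B \<union> (\<lambda>p. (Some p, None)) ` S"

definition all_pairs :: "('a option \<times> 'a option) set" where
  "all_pairs = map_prod Some Some ` B \<union> {(Some p, None) | p. p \<in> S} \<union> {(None, Some q) | q. q \<in> S}"

definition left_mass :: "('a option \<times> 'a option \<Rightarrow> real) \<Rightarrow> real" where
  "left_mass \<alpha> = (\<Sum>p\<in>S. \<alpha> (Some p, None))"

definition right_mass :: "('a option \<times> 'a option \<Rightarrow> real) \<Rightarrow> real" where
  "right_mass \<alpha> = (\<Sum>q\<in>S. \<alpha> (None, Some q))"

text \<open>The future suspension coordinate. On a chain at most one of the two masses is nonzero,
  so its absolute value is the whole mass outside \<open>B\<close>.\<close>

definition height :: "('a option \<times> 'a option \<Rightarrow> real) \<Rightarrow> real" where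
  "height \<alpha> = left_mass \<alpha> - right_mass \<alpha>"

definition coords :: "('a option \<times> 'a option \<Rightarrow> real) \<Rightarrow> ('a \<times> 'a \<Rightarrow> real) \<times> real" where
  "coords \<alpha> = (restrict_weight \<alpha>, height \<alpha>)"

lemma finite_B: "finite B"
  using B_subset finite_S finite_subset by blast

lemma finite_left_part: "finite left_part"
  by (simp add: left_part_def finite_B finite_S)

lemma all_pairs_eq: "all_pairs = left_part \<union> (\<lambda>q. (None, Some q)) ` S"
  by (auto simp: all_pairs_def left_part_def)

lemma finite_all_pairs: "finite all_pairs"
  by (simp add: all_pairs_eq finite_left_part finite_S)

lemma left_part_subset: "left_part \<subseteq> all_pairs"
  by (auto simp: all_pairs_eq)

lemma swap_all_pairs: "prod.swap ` all_pairs \<subseteq> all_pairs"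
  using swap_B by (force simp: all_pairs_def image_subset_iff)

lemma sum_left_part: "sum \<alpha> left_part = sum (restrict_weight \<alpha>) B + left_mass \<alpha>"
proof -
  have "sum \<alpha> left_part = sum \<alpha> (map_prod Some Some ` B) + sum \<alpha> ((\<lambda>p. (Some p, None)) ` S)"
    unfolding left_part_def using finite_B finite_S by (intro sum.union_disjoint) auto
  also have "sum \<alpha> (map_prod Some Some ` B) = sum (restrict_weight \<alpha>) B"
    unfolding restrict_weight_def by (rule sum.reindex) (auto simp: inj_on_def)
  also have "sum \<alpha> ((\<lambda>p. (Some p, None)) ` S) = left_mass \<alpha>"
    unfolding left_mass_def by (subst sum.reindex) (auto simp: inj_on_def)
  finally show ?thesis .
qed

lemma sum_all_pairs:
  "sum \<alpha> all_pairs = sum (restrict_weight \<alpha>) B + left_mass \<alpha> + right_mass \<alpha>"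
proof -
  have "sum \<alpha> all_pairs = sum \<alpha> left_part + sum \<alpha> ((\<lambda>q. (None, Some q)) ` S)"
    unfolding all_pairs_eq using finite_left_part finite_S
    by (intro sum.union_disjoint) (auto simp: left_part_def)
  also have "sum \<alpha> ((\<lambda>q. (None, Some q)) ` S) = right_mass \<alpha>"
    unfolding right_mass_def by (subst sum.reindex) (auto simp: inj_on_def)
  finally show ?thesis by (simp add: sum_left_part)
qed

lemma mass_nonneg:
  assumes "\<alpha> \<in> chain_weights V"
  shows "0 \<le> left_mass \<alpha>" "0 \<le> right_mass \<alpha>"
  using chain_weightsD(1)[OF assms] by (auto simp: left_mass_def right_mass_def sum_nonneg)

text \<open>The pairs \<open>(Some p, None)\<close> and \<open>(None, Some q)\<close> are
  incomparable, so no chain meets both sides. This is what splits the realization into two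
  halves.\<close>

lemma one_sided:
  assumes "\<alpha> \<in> chain_weights V"
  shows "left_mass \<alpha> = 0 \<or> right_mass \<alpha> = 0"
proof (rule ccontr)
  assume "\<not> ?thesis"
  then obtain p q where "\<alpha> (Some p, None) \<noteq> 0" "\<alpha> (None, Some q) \<noteq> 0"
    unfolding left_mass_def right_mass_def by (metis (mono_tags, lifting) sum.neutral)
  then show False
    using chain_weightsD(4)[OF assms, of "(Some p, None)" "(None, Some q)"]
    by (simp add: less_eq_prod_def)
qed

text \<open>Identifies the half on which equivariant maps are prescribed with the realization of a
  poset, where the contraction lives. By \<open>one_sided\<close>, nonnegative height forces the
  right mass to vanish, and then each of its terms.\<close>

lemma chain_points_left_part:
  "{\<alpha> \<in> chain_points all_pairs. 0 \<le> height \<alpha>} = chain_points left_part"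
proof (intro set_eqI iffI)
  fix \<alpha> assume "\<alpha> \<in> chain_points left_part"
  then have \<alpha>: "\<alpha> \<in> chain_weights left_part" "sum \<alpha> left_part = 1"
    by (auto simp: chain_points_def)
  have "right_mass \<alpha> = 0"
    unfolding right_mass_def
    using chain_weightsD(2)[OF \<alpha>(1)] by (intro sum.neutral) (auto simp: left_part_def)
  moreover have "\<alpha> \<in> chain_weights all_pairs"
    using \<alpha>(1) left_part_subset unfolding chain_weights_def by blast
  ultimately show "\<alpha> \<in> {\<alpha> \<in> chain_points all_pairs. 0 \<le> height \<alpha>}"
    using \<alpha>(2) mass_nonneg[OF \<alpha>(1)]
    by (simp add: chain_points_def height_def sum_all_pairs sum_left_part)
next
  fix \<alpha> assume "\<alpha> \<in> {\<alpha> \<in> chain_points all_pairs. 0 \<le> height \<alpha>}"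
  then have \<alpha>: "\<alpha> \<in> chain_weights all_pairs" "sum \<alpha> all_pairs = 1" "0 \<le> height \<alpha>"
    by (auto simp: chain_points_def)
  have right: "right_mass \<alpha> = 0"
    using one_sided[OF \<alpha>(1)] mass_nonneg[OF \<alpha>(1)] \<alpha>(3) by (auto simp: height_def)
  then have "\<alpha> (None, Some q) = 0" if "q \<in> S" for q
    using that chain_weightsD(1)[OF \<alpha>(1)] finite_S
    unfolding right_mass_def by (simp add: sum_nonneg_eq_0_iff)
  then have "\<alpha> v = 0" if "v \<notin> left_part" for v
    using that chain_weightsD(2)[OF \<alpha>(1), of v] by (auto simp: all_pairs_eq)
  then have "\<alpha> \<in> chain_weights left_part"
    using \<alpha>(1) unfolding chain_weights_def by blast
  then show "\<alpha> \<in> chain_points left_part"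
    using \<alpha>(2) right by (simp add: chain_points_def sum_all_pairs sum_left_part)
qed

lemma restrict_weight_chain_weights:
  assumes "\<alpha> \<in> chain_weights all_pairs"
  shows "restrict_weight \<alpha> \<in> chain_weights B"
proof -
  note \<alpha> = chain_weightsD[OF assms]
  have "v \<in> B" if "restrict_weight \<alpha> v \<noteq> 0" for v
    using \<alpha>(3)[of "map_prod Some Some v"] that
    by (cases v) (auto simp: all_pairs_def)
  moreover have "v \<le> w \<or> w \<le> v" if "restrict_weight \<alpha> v \<noteq> 0" "restrict_weight \<alpha> w \<noteq> 0" for v w
    using \<alpha>(4)[of "map_prod Some Some v" "map_prod Some Some w"] that
    by (cases v; cases w) (simp add: less_eq_prod_def)
  moreover have "0 \<le> restrict_weight \<alpha> v" for v
    using \<alpha>(1) by (simp add: restrict_weight_def)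
  ultimately show ?thesis
    unfolding chain_weights_def by blast
qed

lemma coords_in:
  assumes "\<alpha> \<in> chain_points all_pairs"
  shows "coords \<alpha> \<in> chain_suspension B"
proof -
  note w = chain_points_weights[OF assms]
  have "\<bar>height \<alpha>\<bar> + sum (restrict_weight \<alpha>) B = 1"
    using one_sided[OF w] mass_nonneg[OF w] chain_points_sum[OF assms]
    by (auto simp: height_def sum_all_pairs)
  then show ?thesis
    using restrict_weight_chain_weights[OF w] by (simp add: coords_def chain_suspension_def)
qed

lemma height_le_1:
  assumes "\<alpha> \<in> chain_points all_pairs"
  shows "height \<alpha> \<le> 1"
proof -
  have "0 \<le> sum (restrict_weight \<alpha>) B"
    using chain_weightsD(1)[OF restrict_weight_chain_weights[OF chain_points_weights[OF assms]]]
    by (simp add: sum_nonneg)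
  then show ?thesis
    using coords_in[OF assms] by (auto simp: coords_def chain_suspension_def)
qed

lemma height_swap: "height (\<alpha> \<circ> prod.swap) = - height \<alpha>"
  by (simp add: height_def left_mass_def right_mass_def)

lemma coords_swap: "coords (\<alpha> \<circ> prod.swap) = susp_swap (coords \<alpha>)"
  by (simp add: coords_def susp_swap_def height_swap restrict_weight_swap)

lemma left_mass_extend_weight [simp]: "left_mass (extend_weight y) = 0"
  and right_mass_extend_weight [simp]: "right_mass (extend_weight y) = 0"
  by (simp_all add: left_mass_def right_mass_def)

lemma coords_extend_weight: "coords (extend_weight y) = (y, 0)"
  by (simp add: coords_def height_def)

lemma extend_weight_chain_weights:
  assumes "y \<in> chain_weights B"
  shows "extend_weight y \<in> chain_weights left_part"
proof -
  note y = chain_weightsD[OF assms]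
  have "extend_weight y v = 0" if "v \<notin> left_part" for v
  proof (rule ccontr)
    assume "extend_weight y v \<noteq> 0"
    then obtain a b where "v = (Some a, Some b)" "y (a, b) \<noteq> 0"
      by (rule extend_weight_nonzero)
    with y(3)[of "(a, b)"] that show False
      by (force simp: left_part_def)
  qed
  moreover have "0 \<le> extend_weight y v" for v
    using y(1) by (auto simp: extend_weight_def split: prod.splits option.splits)
  moreover have "v \<le> w \<or> w \<le> v" if vw: "extend_weight y v \<noteq> 0" "extend_weight y w \<noteq> 0" for v w
  proof -
    obtain a b where "v = (Some a, Some b)" "y (a, b) \<noteq> 0"
      using vw(1) by (rule extend_weight_nonzero)
    moreover obtain c d where "w = (Some c, Some d)" "y (c, d) \<noteq> 0"
      using vw(2) by (rule extend_weight_nonzero)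
    ultimately show ?thesis
      using y(4)[of "(a, b)" "(c, d)"] by (simp add: less_eq_prod_def)
  qed
  ultimately show ?thesis unfolding chain_weights_def by blast
qed

lemma sum_extend_weight: "sum (extend_weight y) left_part = sum y B"
  by (simp add: sum_left_part)

text \<open>Height 0 together with \<open>one_sided\<close> leaves no mass outside
  \<open>B\<close>.\<close>

lemma extend_restrict_weight:
  assumes "\<alpha> \<in> chain_points left_part" "height \<alpha> = 0"
  shows "extend_weight (restrict_weight \<alpha>) = \<alpha>"
proof
  fix w
  have \<alpha>: "\<alpha> \<in> chain_points all_pairs"
    using assms(1) chain_points_left_part by blast
  note w\<alpha> = chain_points_weights[OF \<alpha>]
  have "left_mass \<alpha> = 0"
    using assms(2) one_sided[OF w\<alpha>] by (auto simp: height_def)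
  then have "\<alpha> (Some p, None) = 0" if "p \<in> S" for p
    using that chain_weightsD(1)[OF w\<alpha>] finite_S
    unfolding left_mass_def by (simp add: sum_nonneg_eq_0_iff)
  then have "\<alpha> (u, v) = 0" if "u = None \<or> v = None" for u v
    using that chain_weightsD(3)[OF chain_points_weights[OF assms(1)], of "(u, v)"]
    by (auto simp: left_part_def)
  then show "extend_weight (restrict_weight \<alpha>) w = \<alpha> w"
    by (auto simp: extend_weight_def split: prod.splits option.splits)
qed

lemma continuous_on_height:
  assumes "continuous_on A f"
  shows "continuous_on A (\<lambda>x. height (f x))"
  unfolding height_def left_mass_def right_mass_def
  by (intro continuous_on_diff continuous_on_sum continuous_on_coord[OF assms])

lemma continuous_on_extend_weight:
  assumes "continuous_on A f"
  shows "continuous_on A (\<lambda>x. extend_weight (f x) w)"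
proof (cases "\<exists>a b. w = (Some a, Some b)")
  case True
  then show ?thesis using continuous_on_coord[OF assms] by auto
next
  case False
  then have "extend_weight y w = 0" for y
    using extend_weight_nonzero by metis
  then show ?thesis by simp
qed

lemma continuous_on_coords: "continuous_on A coords"
proof -
  have "continuous_on A (\<lambda>\<alpha>. restrict_weight \<alpha> v)" for v
    unfolding restrict_weight_def o_apply by (rule continuous_on_coord[OF continuous_on_id])
  then have "continuous_on A (\<lambda>\<alpha>. (restrict_weight \<alpha>, height \<alpha>))"
    by (intro continuous_on_Pair continuous_on_coordinatewise_then_product continuous_on_height
        continuous_on_id)
  then show ?thesis by (simp add: coords_def[abs_def])
qed

end

section \<open>The equivalence\<close>

text \<open>
  The contraction is stationary from time \<open>1/2\<close> on, so that composing it with the normalization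
  \<open>y / (1 - t)\<close> raises no continuity question at the pole \<open>t = 1\<close>.
\<close>

lemma (in enriched_pairs) left_part_contraction:
  assumes "contractible_poset S"
  obtains \<Psi> c where "continuous_on ({0..1} \<times> chain_points left_part) \<Psi>"
    "\<And>s \<alpha>. s \<in> {0..1} \<Longrightarrow> \<alpha> \<in> chain_points left_part \<Longrightarrow> \<Psi> (s, \<alpha>) \<in> chain_points left_part"
    "\<And>\<alpha>. \<alpha> \<in> chain_points left_part \<Longrightarrow> \<Psi> (0, \<alpha>) = \<alpha>"
    "\<And>s \<alpha>. \<alpha> \<in> chain_points left_part \<Longrightarrow> 1/2 \<le> s \<Longrightarrow> \<Psi> (s::real, \<alpha>) = c"
    "\<And>s \<alpha> v. s \<in> {0..1} \<Longrightarrow> \<alpha> \<in> chain_points left_part \<Longrightarrow>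
       restrict_weight (\<Psi> (s, \<alpha>)) v \<noteq> 0 \<Longrightarrow> restrict_weight \<alpha> v \<noteq> 0"
    "c \<in> chain_points left_part" "\<And>v. restrict_weight c v = 0"
proof -
  \<comment> \<open>First entries in \<open>left_part\<close> are never \<open>None\<close>, so
    \<open>the\<close> is harmless there. The composite \<open>?i \<circ> ?r\<close> lowers the
    second entry to \<open>None\<close>.\<close>
  let ?i = "\<lambda>p. (Some p, None) :: 'a option \<times> 'a option" and ?r = "\<lambda>w :: 'a option \<times> 'a option. the (fst w)"
  have r: "?r ` left_part \<subseteq> S" "mono_on left_part ?r"
    using B_subset by (auto simp: left_part_def monotone_on_def less_eq_prod_def)
  have i: "?i ` S \<subseteq> left_part" "mono_on S ?i"
    by (auto simp: left_part_def monotone_on_def less_eq_prod_def)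
  have le: "?i (?r v) \<le> v" if "v \<in> left_part" for v
    using that by (auto simp: left_part_def less_eq_prod_def)
  obtain \<Phi> c where \<Phi>: "continuous_on ({0..1} \<times> chain_points left_part) \<Phi>"
    "\<And>s \<alpha>. s \<in> {0..1} \<Longrightarrow> \<alpha> \<in> chain_points left_part \<Longrightarrow> \<Phi> (s, \<alpha>) \<in> chain_points left_part"
    "\<And>\<alpha>. \<alpha> \<in> chain_points left_part \<Longrightarrow> \<Phi> (0, \<alpha>) = \<alpha>"
    "\<And>\<alpha>. \<alpha> \<in> chain_points left_part \<Longrightarrow> \<Phi> (1::real, \<alpha>) = c"
    "\<And>s \<alpha> v. \<alpha> \<in> chain_points left_part \<Longrightarrow> s \<in> {0..1} \<Longrightarrow> \<Phi> (s, \<alpha>) v \<noteq> 0 \<Longrightarrow>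
      v \<notin> ?i ` S \<Longrightarrow> \<alpha> v \<noteq> 0"
    "c \<in> chain_points left_part" "\<And>v. c v \<noteq> 0 \<Longrightarrow> v \<in> ?i ` S"
    by (rule contraction_through_contractible[OF finite_left_part finite_S assms r i], erule le)
      (rule that; assumption)
  \<comment> \<open>Double speed, stopped at time 1: the contraction is complete at time
    1/2.\<close>
  let ?\<Psi> = "\<lambda>p. \<Phi> (min 1 (2 * fst p), snd p)"
  have "continuous_on ({0..1} \<times> chain_points left_part) ?\<Psi>"
    by (rule continuous_on_compose2[OF \<Phi>(1)])
      (auto intro!: continuous_on_Pair continuous_on_min continuous_on_mult continuous_on_fst
        continuous_on_snd)
  \<comment> \<open>Pairs \<open>map_prod Some Some v\<close> lie outside the image of
    \<open>?i\<close>, so the support clause applies to them.\<close>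
  moreover have "restrict_weight \<alpha> v \<noteq> 0"
    if "s \<in> {0..1}" "\<alpha> \<in> chain_points left_part" "restrict_weight (?\<Psi> (s, \<alpha>)) v \<noteq> 0" for s \<alpha> v
    using \<Phi>(5)[of \<alpha> "min 1 (2 * s)" "map_prod Some Some v"] that
    by (cases v) auto
  moreover have "restrict_weight c v = 0" for v
    using \<Phi>(7)[of "map_prod Some Some v"] by (cases v) auto
  ultimately show ?thesis
    using \<Phi> by (intro that[of ?\<Psi> c]) auto
qed

text \<open>The maps are \<open>coords\<close> and \<open>g\<close>. From the identity to
  \<open>g \<circ> coords\<close> one passes through
  \<open>\<Psi> (height \<alpha>, \<alpha>)\<close>: first the contraction time grows from 0 to the
  height, then the mass outside \<open>B\<close> is removed from the argument. From
  \<open>coords \<circ> g\<close> to the identity a straight line works.\<close>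

lemma (in enriched_pairs) all_pairs_suspension:
  assumes "contractible_poset S"
  shows "Z2_homotopy_equivalent (top_of_set (chain_points all_pairs)) (\<lambda>\<alpha>. \<alpha> \<circ> prod.swap)
    (top_of_set (chain_suspension B)) susp_swap"
proof -
  obtain \<Psi> c where \<Psi>: "continuous_on ({0..1} \<times> chain_points left_part) \<Psi>"
    "\<And>s \<alpha>. s \<in> {0..1} \<Longrightarrow> \<alpha> \<in> chain_points left_part \<Longrightarrow> \<Psi> (s, \<alpha>) \<in> chain_points left_part"
    "\<And>\<alpha>. \<alpha> \<in> chain_points left_part \<Longrightarrow> \<Psi> (0, \<alpha>) = \<alpha>"
    "\<And>s \<alpha>. \<alpha> \<in> chain_points left_part \<Longrightarrow> 1/2 \<le> s \<Longrightarrow> \<Psi> (s::real, \<alpha>) = c"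
    "\<And>s \<alpha> v. s \<in> {0..1} \<Longrightarrow> \<alpha> \<in> chain_points left_part \<Longrightarrow>
       restrict_weight (\<Psi> (s, \<alpha>)) v \<noteq> 0 \<Longrightarrow> restrict_weight \<alpha> v \<noteq> 0"
    and c: "c \<in> chain_points left_part" "\<And>v. restrict_weight c v = 0"
    by (rule left_part_contraction[OF assms]) (rule that; assumption)
  let ?E = "chain_points all_pairs" and ?L = "chain_points left_part" and ?Y = "chain_suspension B"
  let ?\<sigma> = "\<lambda>\<alpha> :: 'a option \<times> 'a option \<Rightarrow> real. \<alpha> \<circ> prod.swap"
  have L: "{\<alpha> \<in> ?E. 0 \<le> height \<alpha>} = ?L"
    by (rule chain_points_left_part)
  have inL: "\<alpha> \<in> ?L" if "\<alpha> \<in> ?E" "0 \<le> height \<alpha>" for \<alpha>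
    using that unfolding L[symmetric] by simp
  have L_in: "\<alpha> \<in> ?E" "0 \<le> height \<alpha>" "height \<alpha> \<le> 1" if "\<alpha> \<in> ?L" for \<alpha>
    using that height_le_1 unfolding L[symmetric] by simp_all
  have \<sigma>: "Z2_space (top_of_set ?E) ?\<sigma>"
    by (rule Z2_space_comp_swap[OF swap_all_pairs])
  have \<tau>: "Z2_space (top_of_set ?Y) susp_swap"
    by (rule Z2_space_susp_swap[OF swap_B])
  have \<sigma>L: "?\<sigma> \<alpha> \<in> ?L" if "\<alpha> \<in> ?L" "height \<alpha> = 0" for \<alpha>
    by (rule inL[OF comp_swap_chain_points[OF L_in(1)[OF that(1)] swap_all_pairs]])
      (simp add: height_swap that(2))

  \<comment> \<open>The map from the suspension to the realization\<close>
  let ?n = "\<lambda>(y, t::real) w. extend_weight y w / (1 - t)"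
  \<comment> \<open>\<open>?n\<close> rescales \<open>y\<close>, of mass 1 - t, to mass 1.
    Contracting for time \<open>t\<close> gives the inclusion of \<open>B\<close> at
    \<open>t = 0\<close> and \<open>c\<close> at \<open>t = 1/2\<close>; the cut there keeps the
    divisor at least 1/2.\<close>
  define g0 where "g0 = (\<lambda>z. if snd z \<le> 1/2 then \<Psi> (snd z, ?n z) else c)"
  define g where "g = equivariant_extension snd susp_swap ?\<sigma> g0"

  have n_in: "?n z \<in> ?L" if "z \<in> ?Y" "0 \<le> snd z" "snd z \<le> 1/2" for z
  proof -
    obtain y t where z: "z = (y, t)" by (cases z)
    have y: "y \<in> chain_weights B" "sum y B = 1 - t"
      using that by (auto simp: z chain_suspension_def)
    have "sum (extend_weight y) left_part \<noteq> 0"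
      using y(2) that(3) by (simp add: z sum_extend_weight)
    from chain_points_normalize[OF extend_weight_chain_weights[OF y(1)] this]
    show ?thesis by (simp add: z sum_extend_weight y(2))
  qed
  have g0_in: "g0 z \<in> ?L" if "z \<in> ?Y" "0 \<le> snd z" for z
  proof (cases "snd z \<le> 1/2")
    case True
    then show ?thesis
      using \<Psi>(2)[OF _ n_in[OF that True]] that(2) by (simp add: g0_def)
  next
    case False
    then show ?thesis using c(1) by (simp add: g0_def)
  qed
  have n_0: "?n z = extend_weight (fst z)" if "snd z = 0" for z
    using that by (auto simp: case_prod_unfold)
  have g0_0: "g0 z = extend_weight (fst z)" if "z \<in> ?Y" "snd z = 0" for z
    using \<Psi>(3)[OF n_in[OF that(1)]] that n_0[OF that(2)] by (simp add: g0_def)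
  have cont_g0: "continuous_on {z \<in> ?Y. 0 \<le> snd z} g0"
    unfolding g0_def
  proof (rule continuous_on_cases_le)
    let ?A = "{z \<in> {z \<in> ?Y. 0 \<le> snd z}. snd z \<le> 1/2}"
    have "continuous_on ?A ?n"
      unfolding case_prod_unfold
      by (intro continuous_on_coordinatewise_then_product continuous_on_divide
          continuous_on_extend_weight continuous_on_fst continuous_on_snd continuous_on_diff
          continuous_on_const continuous_on_id) auto
    then have "continuous_on ?A (\<lambda>z. (snd z, ?n z))"
      by (intro continuous_on_Pair continuous_on_snd continuous_on_id)
    then show "continuous_on ?A (\<lambda>z. \<Psi> (snd z, ?n z))"
      by (rule continuous_on_compose2[OF \<Psi>(1)]) (use n_in in \<open>auto simp del: split_paired_All\<close>)
    show "\<Psi> (snd z, ?n z) = c" if "z \<in> {z \<in> ?Y. 0 \<le> snd z}" "snd z = 1/2" for z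
      using that by (intro \<Psi>(4) n_in) auto
  qed (intro continuous_intros)+

  have f_cont: "continuous_map (top_of_set ?E) (top_of_set ?Y) coords"
    using continuous_on_coords coords_in by auto
  have f_eq: "equivariant (top_of_set ?E) ?\<sigma> susp_swap coords"
    by (simp add: equivariant_def coords_swap)

  \<comment> \<open>The constant homotopy: its existence contains continuity and equivariance of
    \<open>g\<close>.\<close>
  have "homotopic_with (equivariant (top_of_set ?Y) susp_swap ?\<sigma>) (top_of_set ?Y) (top_of_set ?E) g g"
    unfolding g_def
  proof (rule equivariant_extension_homotopy[OF \<tau> \<sigma>, where k = "\<lambda>p. g0 (snd p)", unfolded snd_conv])
    show "continuous_on ({0..1} \<times> {z \<in> ?Y. 0 \<le> snd z}) (\<lambda>p. g0 (snd p))"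
      by (rule continuous_on_compose2[OF cont_g0 continuous_on_snd[OF continuous_on_id]]) auto
    show "g0 (susp_swap z) = ?\<sigma> (g0 z)" if "z \<in> ?Y" "snd z = 0" for z
    proof -
      have "susp_swap z \<in> ?Y" using \<tau> that(1) by (auto simp: Z2_space_def)
      then show ?thesis
        using that by (simp add: g0_0 extend_weight_swap susp_swap_def)
    qed
  qed (auto simp: susp_swap_def continuous_on_snd g0_in L_in)
  then have g_cont: "continuous_map (top_of_set ?Y) (top_of_set ?E) g"
    and g_eq: "equivariant (top_of_set ?Y) susp_swap ?\<sigma> g"
    using homotopic_with_imp_continuous_maps homotopic_with_imp_property by blast+

  \<comment> \<open>Homotopy between the identity and g after coords\<close>
  let ?hat = "equivariant_extension height ?\<sigma> ?\<sigma>"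
  have respects: "equivariant (top_of_set ?E) ?\<sigma> ?\<sigma> h \<longleftrightarrow> equivariant (top_of_set ?E) ?\<sigma> ?\<sigma> k"
    if "\<And>x. x \<in> topspace (top_of_set ?E) \<Longrightarrow> h x = k x" for h k
    using that comp_swap_chain_points[OF _ swap_all_pairs] by (auto simp: equivariant_def)
  have cont_height: "continuous_on ?E height"
    by (rule continuous_on_height[OF continuous_on_id])

  \<comment> \<open>The contraction time is \<open>s\<close> times the height; at height 0 it
    remains 0, so the points of \<open>B\<close> stay fixed.\<close>
  have "homotopic_with (equivariant (top_of_set ?E) ?\<sigma> ?\<sigma>) (top_of_set ?E) (top_of_set ?E)
      (?hat (\<lambda>\<alpha>. \<Psi> (0 * height \<alpha>, \<alpha>))) (?hat (\<lambda>\<alpha>. \<Psi> (1 * height \<alpha>, \<alpha>)))"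
  proof (rule equivariant_extension_homotopy[OF \<sigma> \<sigma> cont_height,
        where k = "\<lambda>p. \<Psi> (fst p * height (snd p), snd p)", unfolded fst_conv snd_conv L])
    have "continuous_on ({0..1} \<times> ?L) (\<lambda>p. (fst p * height (snd p), snd p))"
      by (intro continuous_on_Pair continuous_on_mult continuous_on_height continuous_on_fst
          continuous_on_snd continuous_on_id)
    then show "continuous_on ({0..1} \<times> ?L) (\<lambda>p. \<Psi> (fst p * height (snd p), snd p))"
      by (rule continuous_on_compose2[OF \<Psi>(1)]) (auto simp: L_in mult_le_one)
    show "\<Psi> (s * height \<alpha>, \<alpha>) \<in> ?E" if "s \<in> {0..1}" "\<alpha> \<in> ?E" "0 \<le> height \<alpha>" for s \<alpha>
      using that by (intro L_in(1) \<Psi>(2)) (auto simp: inL mult_le_one height_le_1)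
    show "\<Psi> (s * height (?\<sigma> \<alpha>), ?\<sigma> \<alpha>) = ?\<sigma> (\<Psi> (s * height \<alpha>, \<alpha>))"
      if "\<alpha> \<in> ?E" "height \<alpha> = 0" for s \<alpha>
      using that \<sigma>L by (simp add: height_swap \<Psi>(3) inL)
  qed (simp_all add: height_swap)
  then have hom1: "homotopic_with (equivariant (top_of_set ?E) ?\<sigma> ?\<sigma>) (top_of_set ?E) (top_of_set ?E)
      id (?hat (\<lambda>\<alpha>. \<Psi> (height \<alpha>, \<alpha>)))"
  proof (rule homotopic_with_eq[OF _ _ _ respects])
    fix \<alpha> assume "\<alpha> \<in> topspace (top_of_set ?E)"
    then have "\<alpha> \<in> ?E" "?\<sigma> \<alpha> \<in> ?E"
      using comp_swap_chain_points[OF _ swap_all_pairs] by auto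
    then show "id \<alpha> = ?hat (\<lambda>\<alpha>. \<Psi> (0 * height \<alpha>, \<alpha>)) \<alpha>"
      by (auto simp: equivariant_extension_def \<Psi>(3) inL height_swap fun_eq_iff)
  qed simp_all

  \<comment> \<open>Fades out the mass outside \<open>B\<close> and renormalizes: for \<alpha> in
    the left half the remaining mass is \<open>1 - s * height \<alpha>\<close>. At
    \<open>s = 0\<close> this is \<alpha>, at \<open>s = 1\<close> it is
    \<open>?n (coords \<alpha>)\<close>.\<close>
  let ?m = "\<lambda>s \<alpha> w. ((1 - s) * \<alpha> w + s * extend_weight (restrict_weight \<alpha>) w) / (1 - s * height \<alpha>)"
  define k2 where "k2 = (\<lambda>p. if height (snd p) \<le> 1/2
    then \<Psi> (height (snd p), ?m (fst p) (snd p)) else c)"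
  have small: "s * height \<alpha> \<le> 1/2" if "s \<in> {0..1}" "0 \<le> height \<alpha>" "height \<alpha> \<le> 1/2" for s \<alpha>
    using mult_mono[of s 1 "height \<alpha>" "1/2"] that by simp
  have m_in: "?m s \<alpha> \<in> ?L" if "s \<in> {0..1}" "\<alpha> \<in> ?L" "height \<alpha> \<le> 1/2" for s \<alpha>
  proof -
    let ?b = "\<lambda>w. (1 - s) * \<alpha> w + s * extend_weight (restrict_weight \<alpha>) w"
    note w\<alpha> = chain_points_weights[OF that(2)]
    have "?b \<in> chain_weights left_part"
    proof (rule chain_weights_mono[OF w\<alpha>])
      fix w
      have "extend_weight (restrict_weight \<alpha>) w = \<alpha> w \<or> extend_weight (restrict_weight \<alpha>) w = 0"
        by (auto simp: extend_weight_def split: prod.splits option.splits)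
      then show "0 \<le> ?b w" "?b w \<noteq> 0 \<Longrightarrow> \<alpha> w \<noteq> 0"
        using that(1) chain_weightsD(1)[OF w\<alpha>, of w] by auto
    qed
    moreover have "sum ?b left_part = 1 - s * height \<alpha>"
    proof -
      have "right_mass \<alpha> = 0"
        using one_sided[OF w\<alpha>] mass_nonneg[OF w\<alpha>] L_in(2)[OF that(2)] by (auto simp: height_def)
      then have restr: "sum (restrict_weight \<alpha>) B = 1 - height \<alpha>"
        using chain_points_sum[OF that(2)] by (simp add: sum_left_part height_def)
      have "sum ?b left_part
          = (1 - s) * sum \<alpha> left_part + s * sum (extend_weight (restrict_weight \<alpha>)) left_part"
        by (simp add: sum.distrib sum_distrib_left)
      also have "\<dots> = (1 - s) * 1 + s * (1 - height \<alpha>)"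
        by (simp only: sum_extend_weight restr chain_points_sum[OF that(2)])
      finally show ?thesis by (simp add: algebra_simps)
    qed
    moreover have "1 - s * height \<alpha> \<noteq> 0"
      using small[OF that(1) L_in(2)[OF that(2)] that(3)] by simp
    ultimately show ?thesis
      using chain_points_normalize[of ?b left_part] by simp
  qed
  have m_0: "?m s \<alpha> = \<alpha>" if "\<alpha> \<in> ?L" "height \<alpha> = 0" for s \<alpha>
    using extend_restrict_weight[OF that] that(2) by (simp add: algebra_simps)
  have k2_in: "k2 (s, \<alpha>) \<in> ?L" if "s \<in> {0..1}" "\<alpha> \<in> ?L" for s \<alpha>
    using \<Psi>(2)[OF _ m_in[OF that]] L_in[OF that(2)] c(1) by (auto simp: k2_def)
  have "homotopic_with (equivariant (top_of_set ?E) ?\<sigma> ?\<sigma>) (top_of_set ?E) (top_of_set ?E)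
      (?hat (\<lambda>\<alpha>. k2 (0, \<alpha>))) (?hat (\<lambda>\<alpha>. k2 (1, \<alpha>)))"
  proof (rule equivariant_extension_homotopy[OF \<sigma> \<sigma> cont_height, unfolded L])
    show "continuous_on ({0..1} \<times> ?L) k2"
      unfolding k2_def
    proof (rule continuous_on_cases_le)
      let ?A = "{p \<in> {0..1::real} \<times> ?L. height (snd p) \<le> 1/2}"
      have coord: "continuous_on ?A (\<lambda>p. snd p w)" for w
        by (rule continuous_on_coord[OF continuous_on_snd[OF continuous_on_id]])
      have "continuous_on ?A (\<lambda>p. restrict_weight (snd p))"
        unfolding restrict_weight_def o_def
        by (rule continuous_on_coordinatewise_then_product, rule coord)
      note ext = continuous_on_extend_weight[OF this]
      have "1 - s * height \<alpha> \<noteq> 0" if "(s, \<alpha>) \<in> ?A" for s \<alpha>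
        using that small[of s \<alpha>] L_in[of \<alpha>] by auto
      then have "continuous_on ?A (\<lambda>p. ?m (fst p) (snd p))"
        by (intro continuous_on_coordinatewise_then_product continuous_on_divide continuous_on_add
            continuous_on_mult continuous_on_diff coord ext continuous_on_height continuous_on_const
            continuous_on_fst continuous_on_snd continuous_on_id) auto
      then have "continuous_on ?A (\<lambda>p. (height (snd p), ?m (fst p) (snd p)))"
        by (intro continuous_on_Pair continuous_on_height continuous_on_snd continuous_on_id)
      then show "continuous_on ?A (\<lambda>p. \<Psi> (height (snd p), ?m (fst p) (snd p)))"
        by (rule continuous_on_compose2[OF \<Psi>(1)]) (use m_in L_in in auto)
      show "continuous_on ({0..1} \<times> ?L) (\<lambda>p. height (snd p))"
        by (intro continuous_on_height continuous_on_snd continuous_on_id)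
      show "\<Psi> (height (snd p), ?m (fst p) (snd p)) = c"
        if "p \<in> {0..1} \<times> ?L" "height (snd p) = 1/2" for p
        using that by (intro \<Psi>(4) m_in) auto
    qed (rule continuous_on_const)
    show "k2 (s, \<alpha>) \<in> ?E" if "s \<in> {0..1}" "\<alpha> \<in> ?E" "0 \<le> height \<alpha>" for s \<alpha>
      by (rule L_in(1)[OF k2_in[OF that(1) inL[OF that(2,3)]]])
    show "k2 (s, ?\<sigma> \<alpha>) = ?\<sigma> (k2 (s, \<alpha>))" if "\<alpha> \<in> ?E" "height \<alpha> = 0" for s \<alpha>
    proof -
      have "k2 (s, \<alpha>) = \<alpha>" if "\<alpha> \<in> ?L" "height \<alpha> = 0" for \<alpha>
        unfolding k2_def fst_conv snd_conv m_0[OF that] using that by (simp add: \<Psi>(3))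
      then show ?thesis
        using inL[OF that(1)] that(2) \<sigma>L height_swap[of \<alpha>] by simp
    qed
  qed (simp add: height_swap)
  then have hom2: "homotopic_with (equivariant (top_of_set ?E) ?\<sigma> ?\<sigma>) (top_of_set ?E) (top_of_set ?E)
      (?hat (\<lambda>\<alpha>. \<Psi> (height \<alpha>, \<alpha>))) (g \<circ> coords)"
  proof (rule homotopic_with_eq[OF _ _ _ respects])
    fix \<alpha> assume "\<alpha> \<in> topspace (top_of_set ?E)"
    then have E: "\<alpha> \<in> ?E" "?\<sigma> \<alpha> \<in> ?E"
      using comp_swap_chain_points[OF _ swap_all_pairs] by auto
    \<comment> \<open>Beyond height 1/2 the cut makes no difference, since \<Psi> is already
      constantly \<open>c\<close>.\<close>
    have "k2 (0, \<alpha>) = \<Psi> (height \<alpha>, \<alpha>)" if "\<alpha> \<in> ?L" for \<alpha>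
      using \<Psi>(4)[OF that] by (simp add: k2_def)
    then show "?hat (\<lambda>\<alpha>. \<Psi> (height \<alpha>, \<alpha>)) \<alpha> = ?hat (\<lambda>\<alpha>. k2 (0, \<alpha>)) \<alpha>"
      using inL[OF E(1)] inL[OF E(2)] by (simp add: equivariant_extension_def height_swap)
    have "k2 (1, \<beta>) = g0 (coords \<beta>)" for \<beta>
      by (simp add: k2_def g0_def coords_def)
    then show "(g \<circ> coords) \<alpha> = ?hat (\<lambda>\<alpha>. k2 (1, \<alpha>)) \<alpha>"
      by (simp add: g_def equivariant_extension_def coords_swap[symmetric]) (simp add: coords_def)
  qed simp_all
  have gf: "homotopic_with (equivariant (top_of_set ?E) ?\<sigma> ?\<sigma>) (top_of_set ?E) (top_of_set ?E)
      (g \<circ> coords) id"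
    using homotopic_with_trans[OF hom1 hom2] by (simp add: homotopic_with_sym)

  \<comment> \<open>Homotopy between coords after g and the identity\<close>
  let ?f = "\<lambda>z. coords (g0 z)"
  define k3 where "k3 = (\<lambda>p. let s = fst p; z = snd p in
    (\<lambda>v. (1 - s) * fst (?f z) v + s * fst z v, (1 - s) * snd (?f z) + s * snd z))"
  have "homotopic_with (equivariant (top_of_set ?Y) susp_swap susp_swap) (top_of_set ?Y) (top_of_set ?Y)
      (equivariant_extension snd susp_swap susp_swap (\<lambda>z. k3 (0, z)))
      (equivariant_extension snd susp_swap susp_swap (\<lambda>z. k3 (1, z)))"
  proof (rule equivariant_extension_homotopy[OF \<tau> \<tau>])
    let ?A = "{0..1::real} \<times> {z \<in> ?Y. 0 \<le> snd z}"
    have f: "continuous_on ?A (\<lambda>p. ?f (snd p))"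
      by (rule continuous_on_compose2[OF continuous_on_coords[of UNIV]
            continuous_on_compose2[OF cont_g0 continuous_on_snd[OF continuous_on_id]]]) auto
    have "continuous_on ?A (\<lambda>p. fst (?f (snd p)) v)" "continuous_on ?A (\<lambda>p. fst (snd p) v)" for v
      by (rule continuous_on_coord[OF continuous_on_fst[OF f]])
        (rule continuous_on_coord[OF continuous_on_fst[OF continuous_on_snd[OF continuous_on_id]]])
    then show "continuous_on ?A k3"
      unfolding k3_def Let_def
      by (intro continuous_on_Pair continuous_on_coordinatewise_then_product continuous_on_add
          continuous_on_mult continuous_on_diff continuous_on_const continuous_on_snd[OF f]
          continuous_on_fst continuous_on_snd continuous_on_id)
    show "k3 (s, z) \<in> ?Y" if s: "s \<in> {0..1}" and z: "z \<in> ?Y" "0 \<le> snd z" for s z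
    proof -
      obtain y t where yt: "z = (y, t)" by (cases z)
      let ?u = "restrict_weight (g0 z)"
      have y: "y \<in> chain_weights B" "t + sum y B = 1" "0 \<le> t"
        using z by (auto simp: yt chain_suspension_def)
      have g0: "g0 z \<in> ?L" by (rule g0_in[OF z])
      have u: "?u \<in> chain_weights B" "height (g0 z) + sum ?u B = 1" "0 \<le> height (g0 z)"
        using coords_in[OF L_in(1)[OF g0]] L_in(2)[OF g0]
        by (simp_all add: coords_def chain_suspension_def)
      \<comment> \<open>The support clause of the contraction: the \<open>B\<close>-part of
        \<open>g0 z\<close> stays on the chain carrying \<open>y\<close>, so convex combinations
        with \<open>y\<close> are again carried by a chain.\<close>
      have supp: "y v \<noteq> 0" if "?u v \<noteq> 0" for v
      proof (cases "t \<le> 1/2")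
        case True
        have "?n z \<in> ?L"
          by (rule n_in[OF z]) (use True in \<open>simp add: yt\<close>)
        moreover have "restrict_weight (\<Psi> (t, ?n z)) v \<noteq> 0"
          using that True by (simp add: g0_def yt)
        moreover have "t \<in> {0..1}"
          using True y(3) by simp
        ultimately have "restrict_weight (?n z) v \<noteq> 0"
          using \<Psi>(5) by blast
        then show ?thesis
          by (cases v) (simp add: yt)
      next
        case False
        then show ?thesis using that c(2) by (simp add: g0_def yt)
      qed
      let ?w = "\<lambda>v. (1 - s) * ?u v + s * y v"
      have "?w \<in> chain_weights B"
      proof (rule chain_weights_mono[OF y(1)])
        show "0 \<le> ?w v" for v
          using s chain_weightsD(1)[OF u(1)] chain_weightsD(1)[OF y(1)] by simp
        show "y v \<noteq> 0" if "?w v \<noteq> 0" for v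
          using that supp[of v] by auto
      qed
      moreover have "sum ?w B = (1 - s) * (1 - height (g0 z)) + s * (1 - t)"
      proof -
        have "sum ?w B = (1 - s) * sum ?u B + s * sum y B"
          by (simp add: sum.distrib sum_distrib_left)
        moreover have "sum ?u B = 1 - height (g0 z)" "sum y B = 1 - t"
          using u(2) y(2) by simp_all
        ultimately show ?thesis by (simp only:)
      qed
      \<comment> \<open>Both ends have nonnegative height, so the absolute value in
        \<open>chain_suspension\<close> is affine along the segment.\<close>
      moreover have "0 \<le> (1 - s) * height (g0 z) + s * t"
        using s u(3) y(3) by simp
      moreover have "k3 (s, z) = (?w, (1 - s) * height (g0 z) + s * t)"
        by (simp add: k3_def Let_def coords_def yt)
      moreover have "(1 - s) * height (g0 z) + s * t
          + ((1 - s) * (1 - height (g0 z)) + s * (1 - t)) = 1"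
        by (simp add: algebra_simps)
      ultimately show ?thesis
        unfolding chain_suspension_def by simp
    qed
    show "k3 (s, susp_swap z) = susp_swap (k3 (s, z))" if "z \<in> ?Y" "snd z = 0" for s z
    proof -
      \<comment> \<open>On the equator \<open>g0\<close> is extension by zero, which
        \<open>coords\<close> undoes: the segment degenerates to a point.\<close>
      have k3: "k3 (s, z) = z" if "z \<in> ?Y" "snd z = 0" for z
        using that by (cases z) (simp add: k3_def Let_def g0_0 coords_extend_weight algebra_simps)
      have "susp_swap z \<in> ?Y" using \<tau> that(1) by (auto simp: Z2_space_def)
      then show ?thesis
        using k3[of z] k3[of "susp_swap z"] that by (simp add: susp_swap_def)
    qed
  qed (simp_all add: susp_swap_def continuous_on_snd)
  \<comment> \<open>Since \<open>coords\<close> commutes with the involutions, composing with it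
    commutes with equivariant extension.\<close>
  moreover have "equivariant_extension snd susp_swap susp_swap (\<lambda>z. k3 (0, z)) = coords \<circ> g"
    by (rule ext) (simp add: k3_def Let_def g_def equivariant_extension_def coords_swap)
  moreover have "equivariant_extension snd susp_swap susp_swap (\<lambda>z. k3 (1, z)) = id"
    by (rule ext) (simp add: k3_def Let_def equivariant_extension_def susp_swap_def comp_assoc)
  ultimately have fg: "homotopic_with (equivariant (top_of_set ?Y) susp_swap susp_swap)
      (top_of_set ?Y) (top_of_set ?Y) (coords \<circ> g) id"
    by simp

  show ?thesis
    unfolding Z2_homotopy_equivalent_def
    by (intro conjI exI[of _ coords] exI[of _ g] \<sigma> \<tau> f_cont f_eq g_cont g_eq gf fg)
qed

lemma realization_map_swap_eq: "realization_map prod.swap = (\<lambda>\<alpha>. \<alpha> \<circ> prod.swap)"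
  by (rule ext) (rule realization_map_swap)

theorem theorem4p4:
  fixes P S :: "'a::order set" and C :: "'a \<Rightarrow> 'a"
  assumes "weakly_involutive_poset P C"
    and "finite S" and "P \<subseteq> S"
    and "contractible_poset S"
  shows "Z2_homotopy_equivalent
           (geometric_realization (order_complex (enriched_box_poset S P C)))
           (realization_map prod.swap)
           (suspension (geometric_realization (order_complex (box_poset P C))))
           (susp_involution (realization_map prod.swap))"
proof -
  interpret enriched_pairs S "box_poset P C"
    using assms(2,3) by unfold_locales (auto simp: box_poset_def)
  have E: "geometric_realization (order_complex (enriched_box_poset S P C))
      = top_of_set (chain_points all_pairs)"
    using geometric_realization_order_complex[OF finite_all_pairs]
    by (simp add: enriched_box_poset_def all_pairs_def)
  have B: "geometric_realization (order_complex (box_poset P C))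
      = top_of_set (chain_points (box_poset P C))"
    by (rule geometric_realization_order_complex[OF finite_B])
  \<comment> \<open>\<open>susp_coords\<close> carries \<open>susp_involution\<close> to
    \<open>susp_swap\<close>, so the equivalence with the coordinate model suffices.\<close>
  obtain \<psi> where "homeomorphic_maps (suspension (top_of_set (chain_points (box_poset P C))))
      (top_of_set (chain_suspension (box_poset P C))) susp_coords \<psi>"
    using homeomorphic_map_susp_coords[OF finite_B] by (auto simp: homeomorphic_map_maps)
  then show ?thesis
    unfolding E B realization_map_swap_eq
  proof (rule Z2_homotopy_equivalent_homeomorphic[OF all_pairs_suspension[OF assms(4)]])
    show "susp_involution (\<lambda>\<alpha>. \<alpha> \<circ> prod.swap) `
        topspace (suspension (top_of_set (chain_points (box_poset P C))))
      \<subseteq> topspace (suspension (top_of_set (chain_points (box_poset P C))))"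
      using comp_swap_chain_points[OF _ swap_B]
      by (auto simp: topspace_suspension susp_points_def)
    show "equivariant (suspension (top_of_set (chain_points (box_poset P C))))
        (susp_involution (\<lambda>\<alpha>. \<alpha> \<circ> prod.swap)) susp_swap susp_coords"
      by (auto simp: equivariant_def topspace_suspension susp_points_def susp_swap_def fun_eq_iff)
  qed
qed

end
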